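(* Consider Algorithm iBDCA (described in the context). If the algorithm terminates at an iteration $k$ with $d^k=0$, then it returns a critical point of the DC problem $\min_{x\in\mathcal X}G_\rho(x)-H_\rho(x)$. Suppose instead that the algorithm generates an infinite sequence $\{x^k\}$ and that an accumulation point $\bar x$ of $\{x^k\}$ satisfies the local no-ties condition: for every $t=1,\dots,T$, the set $$\mathcal M_{\alpha,t}(\bar x^t)=\operatorname*{arg\,max}_{q\in Q_{\alpha,t}}\Big\{-\sum_{j=1}^{S_t}q_j(\xi_j^t)^\top\bar x^t\Big\}$$ is a singleton. Then the sequence has finite length, $$\sum_{k=0}^\infty\|x^{k+1}-x^k\|<+\infty,$$ and the whole sequence $\{x^k\}$ converges to $\bar x$, which is a critical point of $\min_{x\in\mathcal X}G_\rho(x)-H_\rho(x)$. Moreover, the convergence is $R$-linear: there exist constants $C>0$, $\omega\in(0,1)$, and an integer $K\ge0$ such that $$\|x^k-\bar x\|\le C\,\omega^{k-K},\qquad k\ge K.$$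
   Context: Model. Let $n,T\in\mathbb N=\{1,2,\dots\}$. Let $X:=\{z\in\mathbb R^n:\sum_{i=1}^n z_i=1,\ z_i\ge 0,\ i=1,\dots,n\}$ and $\mathcal X:=X^T\subset(\mathbb R^n)^T\cong\mathbb R^{nT}$; elements are written $x=(x^1,\dots,x^T)$ with blocks $x^t\in\mathbb R^n$, and $\|\cdot\|$ is the Euclidean norm. Fix $w_{\mathrm{prev}}\in X$. For each $t=1,\dots,T$ let $S_t\in\mathbb N$ and let $\xi^t$ be a discrete random vector taking values $\xi^t_j\in\mathbb R^n$ with probabilities $p^t_j>0$, $j=1,\dots,S_t$, $\sum_{j=1}^{S_t}p^t_j=1$; put $\mu^t:=\sum_{j=1}^{S_t}p_j^t\xi_j^t$ and $L_j^t(z):=-(\xi_j^t)^\top z$. Fix $\alpha\in(0,1)$, $\lambda_1>0$, $\lambda_2>0$, $c_i\ge 0$ ($i=1,\dots,n$), and $\tau\in\mathbb R$. Let $(a)_+:=\max\{a,0\}$. For a real random variable $L$, $\operatorname{VaR}_\alpha(L):=\inf\{u\in\mathbb R:\mathbb P(L\le u)\ge\alpha\}$. $f(x):=-\sum_{t=1}^T(\mu^t)^\top x^t+\lambda_1\Big[\sum_{i=1}^n c_i|x_i^1-(w_{\mathrm{prev}})_i|+\sum_{t=2}^T\sum_{i=1}^n c_i|x_i^t-x_i^{t-1}|\Big]+\lambda_2\sum_{t=1}^T\|x^t\|^2$; $R(x):=\sum_{t=1}^T\big(\operatorname{VaR}_\alpha(-(\xi^t)^\top x^t)-\tau\big)_+$;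 for $\rho>0$, $\Phi_\rho:=f+\rho R$. DC decomposition. For $\beta\in(0,1)$ let $\psi_{\beta,t}(z):=\min_{u\in\mathbb R}\{u+\frac1{1-\beta}\sum_{j=1}^{S_t}p_j^t(L_j^t(z)-u)_+\}$ (the CVaR at level $\beta$ of $-(\xi^t)^\top z$). It has the dual representation $\psi_{\beta,t}(z)=\max_{q\in Q_{\beta,t}}\{-\sum_{j}q_j(\xi_j^t)^\top z\}$ with $Q_{\beta,t}:=\{q\in\mathbb R^{S_t}:\sum_{j}q_j=1,\ 0\le q_j\le\frac{p_j^t}{1-\beta},\ j=1,\dots,S_t\}$. Let $\bar\varepsilon_t:=\alpha-\max\{\sum_{j\in J}p_j^t: J\subseteq\{1,\dots,S_t\},\ \sum_{j\in J}p_j^t<\alpha\}$ (empty sum $=0$), fix $0<\gamma<\min_t\bar\varepsilon_t$, and set $A_\gamma:=\frac{1-\alpha+\gamma}{\gamma}$, $B_\gamma:=\frac{1-\alpha}{\gamma}$. Then $\operatorname{VaR}_\alpha(-(\xi^t)^\top z)=A_\gamma\psi_{\alpha-\gamma,t}(z)-B_\gamma\psi_{\alpha,t}(z)$ and $\Phi_\rho=G_\rho-H_\rho$ with $G_\rho(x):=f(x)+\rho\sum_{t=1}^T\max\{A_\gamma\psi_{\alpha-\gamma,t}(x^t)-\tau,\ B_\gamma\psi_{\alpha,t}(x^t)\}$, $H_\rho(x):=\rho B_\gamma\sum_{t=1}^T\psi_{\alpha,t}(x^t)$. For fixed $\nu>0$: $\widehat G_\rho:=G_\rho+\frac\nu2\|\cdot\|^2$,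 $\widehat H_\rho:=H_\rho+\frac\nu2\|\cdot\|^2$. For convex functions $\partial$ is the convex subdifferential. Critical point: $\bar x\in\mathcal X$ is critical for $\min_{x\in\mathcal X}G_\rho(x)-H_\rho(x)$ if $\partial H_\rho(\bar x)\cap(\partial G_\rho(\bar x)+N_{\mathcal X}(\bar x))\neq\varnothing$, where $N_{\mathcal X}(\bar x)=\{v:\langle v,y-\bar x\rangle\le0\ \forall y\in\mathcal X\}$. Algorithm iBDCA. Input: $\rho>0$, $x^{-1}=x^0\in\mathcal X$, $\theta\in[0,1)$, $\nu>0$, $\sigma\in(0,\lambda_2+\nu)$, $\eta\in(0,1)$, $\bar\lambda>1$, $\varepsilon_{\mathrm{tol}}\ge0$. Here superscript $k$ indexes iterates in $\mathcal X$, $w^{k,t}$ is the $t$-th block of $w^k$, and $\bar x^t$ is the $t$-th block of $\bar x$; $\Pi_{\mathcal X}$ is Euclidean projection onto $\mathcal X$. For $k=0,1,2,\dots$: 1. $w^k=\Pi_{\mathcal X}(x^k+\theta(x^k-x^{k-1}))$; if $\Phi_\rho(w^k)>\Phi_\rho(x^k)$, reset $w^k=x^k$. 2. For each $t$ compute $g_{\alpha,t}(w^{k,t})=-\frac{1}{1-\alpha}\sum_{j}p_j^t\vartheta_j\xi_j^t\in\partial\psi_{\alpha,t}(w^{k,t})$, where, for a minimizer $u^*$ in the definition of $\psi_{\alpha,t}(w^{k,t})$, $\vartheta_j=1$ if $L_j^t(w^{k,t})>u^*$, $\vartheta_j\in[0,1]$ if $L_j^t(w^{k,t})=u^*$, $\vartheta_j=0$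 if $L_j^t(w^{k,t})<u^*$, and $\sum_jp_j^t\vartheta_j=1-\alpha$. Set $s^k=\rho B_\gamma(g_{\alpha,1}(w^{k,1}),\dots,g_{\alpha,T}(w^{k,T}))\in\partial H_\rho(w^k)$ and $u^k=s^k+\nu w^k\in\partial\widehat H_\rho(w^k)$. 3. $y^k=\operatorname*{arg\,min}_{x\in\mathcal X}\{\widehat G_\rho(x)-\langle u^k,x\rangle\}$ (unique solution); $d^k=y^k-w^k$. 4. If $\|d^k\|=0$, return $w^k$. If $\varepsilon_{\mathrm{tol}}>0$ and $\|d^k\|\le\varepsilon_{\mathrm{tol}}\max\{1,\|w^k\|\}$, return $w^k$. 5. (Line search) $\lambda_k^{\max}=\max\{\lambda\ge1:w^k+\lambda d^k\in\mathcal X\}$; $\lambda_k=\min\{\bar\lambda,\lambda_k^{\max}\}$. While $\lambda_k>1$ and $\Phi_\rho(w^k+\lambda_kd^k)>\min\{\Phi_\rho(y^k),\ \Phi_\rho(w^k)-\sigma\lambda_k^2\|d^k\|^2\}$, set $\lambda_k=\max\{1,\eta\lambda_k\}$. 6. $x^{k+1}=w^k+\lambda_kd^k$. "Infinite sequence generated" means the algorithm never returns. *)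

theory Defs
  imports "HOL-Probability.Probability" "HOL-Library.While_Combinator"
begin

section \<open>Convex analysis\<close>

definition subdifferential :: "('a::real_inner \<Rightarrow> real) \<Rightarrow> 'a \<Rightarrow> 'a set"
  where "subdifferential h x = {g. \<forall>y. h y \<ge> h x + g \<bullet> (y - x)}"

definition normal_cone :: "'a::real_inner set \<Rightarrow> 'a \<Rightarrow> 'a set"
  where "normal_cone C x = {v. \<forall>y\<in>C. v \<bullet> (y - x) \<le> 0}"

definition dc_critical :: "'a::real_inner set \<Rightarrow> ('a \<Rightarrow> real) \<Rightarrow> ('a \<Rightarrow> real) \<Rightarrow> 'a \<Rightarrow> bool"
  where "dc_critical C G H x \<longleftrightarrow>
    x \<in> C \<and> subdifferential H x \<inter> {a + b | a b. a \<in> subdifferential G x \<and> b \<in> normal_cone C x} \<noteq> {}"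

definition VaR :: "'w measure \<Rightarrow> real \<Rightarrow> ('w \<Rightarrow> real) \<Rightarrow> real"
  where "VaR M a L = Inf {u. \<P>(\<omega> in M. L \<omega> \<le> u) \<ge> a}"


section \<open>The multi-period portfolio model\<close>

text \<open>
  The stages \<open>1, \<dots>, T\<close> are the elements of a finite linearly ordered type \<open>'t\<close>, and the
  assets \<open>1, \<dots>, n\<close> are those of \<open>'n\<close>. The library norm and inner product of
  \<open>real ^ 'n ^ 't\<close> are the Euclidean ones of the \<open>nT\<close>-dimensional space.
  Scenarios of stage \<open>t\<close> are numbered by \<open>{1..nscen P t}\<close>; \<open>scen\<close> and \<open>wt\<close> carry no
  information outside that range.
\<close>

type_synonym ('n, 't) plan = "((real, 'n) vec, 't) vec"

record ('w, 'n::finite, 't) portfolio =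
  sample :: "'w measure"
  xi :: "'t \<Rightarrow> 'w \<Rightarrow> real ^ 'n"
  nscen :: "'t \<Rightarrow> nat"
  scen :: "'t \<Rightarrow> nat \<Rightarrow> real ^ 'n"
  wt :: "'t \<Rightarrow> nat \<Rightarrow> real"
  wprev :: "real ^ 'n"
  level :: real   \<comment> \<open>\<open>\<alpha>\<close>\<close>
  lam1 :: real
  lam2 :: real
  cost :: "'n \<Rightarrow> real"
  tau :: real
  gam :: real     \<comment> \<open>\<open>\<gamma>\<close>, the shift used in the DC decomposition\<close>

definition simplex1 :: "(real ^ 'n) set"
  where "simplex1 = {z. (\<Sum>i\<in>UNIV. z $ i) = 1 \<and> (\<forall>i. 0 \<le> z $ i)}"

definition feasible :: "(('n::finite, 't::finite) plan) set"
  where "feasible = {x. \<forall>t. x $ t \<in> simplex1}"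

definition scenarios :: "('w, 'n::finite, 't) portfolio \<Rightarrow> 't \<Rightarrow> nat set"
  where "scenarios P t = {1..nscen P t}"

definition eps_bar :: "('w, 'n::finite, 't) portfolio \<Rightarrow> 't \<Rightarrow> real"
  where "eps_bar P t = level P -
    Max {\<Sum>j\<in>J. wt P t j | J. J \<subseteq> scenarios P t \<and> (\<Sum>j\<in>J. wt P t j) < level P}"

text \<open>
  The law of \<open>xi P t\<close> is given through the mass of every point \<open>v\<close>; if the values
  \<open>scen P t j\<close> are pairwise distinct this says that \<open>scen P t j\<close> is taken with probability
  \<open>wt P t j\<close>, and otherwise the weights of coinciding values add up.
\<close>

locale portfolio_model =
  fixes P :: "('w, 'n::finite, 't::{finite,linorder}) portfolio"
  assumes prob_space: "prob_space (sample P)"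
    and random_vector: "\<And>t. xi P t \<in> borel_measurable (sample P)"
    and law: "\<And>t v. \<P>(\<omega> in sample P. xi P t \<omega> = v) = (\<Sum>j | j \<in> scenarios P t \<and> scen P t j = v. wt P t j)"
    and nscen_ge_1: "\<And>t. nscen P t \<ge> 1"
    and wt_pos: "\<And>t j. j \<in> scenarios P t \<Longrightarrow> wt P t j > 0"
    and wt_sum: "\<And>t. (\<Sum>j\<in>scenarios P t. wt P t j) = 1"
    and wprev: "wprev P \<in> simplex1"
    and level: "0 < level P" "level P < 1"
    and lam1_pos: "lam1 P > 0"
    and lam2_pos: "lam2 P > 0"
    and cost_nonneg: "\<And>i. cost P i \<ge> 0"
    and gam: "0 < gam P" "gam P < (MIN t. eps_bar P t)"

definition mu :: "('w, 'n::finite, 't) portfolio \<Rightarrow> 't \<Rightarrow> real ^ 'n"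
  where "mu P t = (\<Sum>j\<in>scenarios P t. wt P t j *\<^sub>R scen P t j)"

definition loss :: "('w, 'n::finite, 't) portfolio \<Rightarrow> 't \<Rightarrow> nat \<Rightarrow> real ^ 'n \<Rightarrow> real"
  where "loss P t j z = - (scen P t j \<bullet> z)"

definition first_stage :: "'t::{finite,linorder}"
  where "first_stage = Min UNIV"

text \<open>The immediate predecessor of a stage; only used for stages other than the first.\<close>
definition prev_stage :: "'t::{finite,linorder} \<Rightarrow> 't"
  where "prev_stage t = Max {s. s < t}"

definition obj :: "('w, 'n::finite, 't::{finite,linorder}) portfolio \<Rightarrow> ('n, 't) plan \<Rightarrow> real"
  where "obj P x =
    - (\<Sum>t\<in>UNIV. mu P t \<bullet> x $ t)
    + lam1 P * ((\<Sum>i\<in>UNIV. cost P i * \<bar>x $ first_stage $ i - wprev P $ i\<bar>)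
              + (\<Sum>t\<in>UNIV - {first_stage}. \<Sum>i\<in>UNIV. cost P i * \<bar>x $ t $ i - x $ prev_stage t $ i\<bar>))
    + lam2 P * (\<Sum>t\<in>UNIV. (norm (x $ t))\<^sup>2)"

definition risk :: "('w, 'n::finite, 't::finite) portfolio \<Rightarrow> ('n, 't) plan \<Rightarrow> real"
  where "risk P x = (\<Sum>t\<in>UNIV. max (VaR (sample P) (level P) (\<lambda>\<omega>. - (xi P t \<omega> \<bullet> x $ t)) - tau P) 0)"

definition Phi :: "('w, 'n::finite, 't::{finite,linorder}) portfolio \<Rightarrow> real \<Rightarrow> ('n, 't) plan \<Rightarrow> real"
  where "Phi P \<rho> x = obj P x + \<rho> * risk P x"


section \<open>DC decomposition\<close>

definition cvar_fun :: "('w, 'n::finite, 't) portfolio \<Rightarrow> real \<Rightarrow> 't \<Rightarrow> real ^ 'n \<Rightarrow> real \<Rightarrow> real"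
  where "cvar_fun P \<beta> t z u = u + 1 / (1 - \<beta>) * (\<Sum>j\<in>scenarios P t. wt P t j * max (loss P t j z - u) 0)"

definition psi :: "('w, 'n::finite, 't) portfolio \<Rightarrow> real \<Rightarrow> 't \<Rightarrow> real ^ 'n \<Rightarrow> real"
  where "psi P \<beta> t z = (INF u. cvar_fun P \<beta> t z u)"

text \<open>
  Vectors indexed by the scenarios are functions with the fixed value \<open>undefined\<close> off
  the index set, so that distinct elements differ at a scenario.
\<close>
definition Qset :: "('w, 'n::finite, 't) portfolio \<Rightarrow> real \<Rightarrow> 't \<Rightarrow> (nat \<Rightarrow> real) set"
  where "Qset P \<beta> t = {q \<in> scenarios P t \<rightarrow>\<^sub>E UNIV.
    (\<Sum>j\<in>scenarios P t. q j) = 1 \<and> (\<forall>j\<in>scenarios P t. 0 \<le> q j \<and> q j \<le> wt P t j / (1 - \<beta>))}"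

definition Mset :: "('w, 'n::finite, 't) portfolio \<Rightarrow> real \<Rightarrow> 't \<Rightarrow> real ^ 'n \<Rightarrow> (nat \<Rightarrow> real) set"
  where "Mset P \<beta> t z =
    {q. is_arg_max (\<lambda>q. - (\<Sum>j\<in>scenarios P t. q j * (scen P t j \<bullet> z))) (\<lambda>q. q \<in> Qset P \<beta> t) q}"

definition Agam :: "('w, 'n::finite, 't) portfolio \<Rightarrow> real"
  where "Agam P = (1 - level P + gam P) / gam P"

definition Bgam :: "('w, 'n::finite, 't) portfolio \<Rightarrow> real"
  where "Bgam P = (1 - level P) / gam P"

definition Gfun :: "('w, 'n::finite, 't::{finite,linorder}) portfolio \<Rightarrow> real \<Rightarrow> ('n, 't) plan \<Rightarrow> real"
  where "Gfun P \<rho> x = obj P x + \<rho> * (\<Sum>t\<in>UNIV.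
    max (Agam P * psi P (level P - gam P) t (x $ t) - tau P) (Bgam P * psi P (level P) t (x $ t)))"

definition Hfun :: "('w, 'n::finite, 't::finite) portfolio \<Rightarrow> real \<Rightarrow> ('n, 't) plan \<Rightarrow> real"
  where "Hfun P \<rho> x = \<rho> * Bgam P * (\<Sum>t\<in>UNIV. psi P (level P) t (x $ t))"

definition Ghat :: "('w, 'n::finite, 't::{finite,linorder}) portfolio \<Rightarrow> real \<Rightarrow> real \<Rightarrow> ('n, 't) plan \<Rightarrow> real"
  where "Ghat P \<rho> \<nu> x = Gfun P \<rho> x + \<nu> / 2 * (norm x)\<^sup>2"


section \<open>The algorithm\<close>

record ibdca_params =
  rho :: real
  theta :: real
  nu :: real
  sigma :: real
  eta :: real
  lambar :: real
  epstol :: real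

definition valid_params :: "('w, 'n::finite, 't) portfolio \<Rightarrow> ibdca_params \<Rightarrow> bool"
  where "valid_params P A \<longleftrightarrow>
    rho A > 0 \<and> 0 \<le> theta A \<and> theta A < 1 \<and> nu A > 0 \<and>
    0 < sigma A \<and> sigma A < lam2 P + nu A \<and> 0 < eta A \<and> eta A < 1 \<and> lambar A > 1 \<and> epstol A \<ge> 0"

text \<open>\<open>x\<close> is the current iterate and \<open>xp\<close> the preceding one.\<close>
definition extrapolate ::
    "('w, 'n::finite, 't::{finite,linorder}) portfolio \<Rightarrow> ibdca_params \<Rightarrow> ('n, 't) plan \<Rightarrow> ('n, 't) plan \<Rightarrow> ('n, 't) plan"
  where "extrapolate P A xp x =
    (let w = closest_point feasible (x + theta A *\<^sub>R (x - xp))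
     in if Phi P (rho A) w > Phi P (rho A) x then x else w)"

text \<open>
  The vectors \<open>g\<close> that the algorithm may choose as the subgradient at \<open>z\<close>, over all
  minimizers \<open>u\<close> and all admissible tie-breaking weights \<open>th\<close>.
\<close>
definition cvar_subgrads :: "('w, 'n::finite, 't) portfolio \<Rightarrow> 't \<Rightarrow> real ^ 'n \<Rightarrow> (real ^ 'n) set"
  where "cvar_subgrads P t z =
    {g. \<exists>u th. is_arg_min (cvar_fun P (level P) t z) (\<lambda>_. True) u \<and>
        (\<forall>j\<in>scenarios P t.
           (loss P t j z > u \<longrightarrow> th j = 1) \<and>
           (loss P t j z = u \<longrightarrow> 0 \<le> th j \<and> th j \<le> 1) \<and>
           (loss P t j z < u \<longrightarrow> th j = 0)) \<and>
        (\<Sum>j\<in>scenarios P t. wt P t j * th j) = 1 - level P \<and>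
        g = - (1 / (1 - level P)) *\<^sub>R (\<Sum>j\<in>scenarios P t. (wt P t j * th j) *\<^sub>R scen P t j)}"

text \<open>A relation rather than a function, because the subgradients \<open>g\<close> may be chosen freely.\<close>
definition ibdca_iteration ::
    "('w, 'n::finite, 't::{finite,linorder}) portfolio \<Rightarrow> ibdca_params \<Rightarrow> ('n, 't) plan \<Rightarrow> ('n, 't) plan
     \<Rightarrow> ('n, 't) plan \<Rightarrow> ('n, 't) plan \<Rightarrow> bool"
  where "ibdca_iteration P A xp x w y \<longleftrightarrow>
    w = extrapolate P A xp x \<and>
    (\<exists>g s u. (\<forall>t. g $ t \<in> cvar_subgrads P t (w $ t)) \<and>
       s = (rho A * Bgam P) *\<^sub>R g \<and>
       u = s + nu A *\<^sub>R w \<and>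
       is_arg_min (\<lambda>v. Ghat P (rho A) (nu A) v - u \<bullet> v) (\<lambda>v. v \<in> feasible) y)"

definition ibdca_stop :: "ibdca_params \<Rightarrow> ('n::finite, 't::finite) plan \<Rightarrow> ('n, 't) plan \<Rightarrow> bool"
  where "ibdca_stop A w y \<longleftrightarrow>
    norm (y - w) = 0 \<or> (epstol A > 0 \<and> norm (y - w) \<le> epstol A * max 1 (norm w))"

definition max_step :: "('n::finite, 't::finite) plan \<Rightarrow> ('n, 't) plan \<Rightarrow> real"
  where "max_step w d = (GREATEST l. l \<ge> 1 \<and> w + l *\<^sub>R d \<in> feasible)"

definition line_search ::
    "('w, 'n::finite, 't::{finite,linorder}) portfolio \<Rightarrow> ibdca_params \<Rightarrow> ('n, 't) plan \<Rightarrow> ('n, 't) plan \<Rightarrow> real"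
  where "line_search P A w y =
    (let d = y - w in
     while (\<lambda>l. l > 1 \<and> Phi P (rho A) (w + l *\<^sub>R d)
                 > min (Phi P (rho A) y) (Phi P (rho A) w - sigma A * l\<^sup>2 * (norm d)\<^sup>2))
       (\<lambda>l. max 1 (eta A * l))
       (min (lambar A) (max_step w d)))"

text \<open>
  Iterations \<open>0, \<dots>, k - 1\<close> were all completed without returning. Natural number subtraction
  makes \<open>x (i - 1)\<close> equal to \<open>x 0\<close> for \<open>i = 0\<close>, which is the initialization in which
  the iterate of index \<open>-1\<close> equals the one of index \<open>0\<close>.
\<close>
definition ibdca_run ::
    "('w, 'n::finite, 't::{finite,linorder}) portfolio \<Rightarrow> ibdca_params \<Rightarrow> (nat \<Rightarrow> ('n, 't) plan) \<Rightarrow> (nat \<Rightarrow> ('n, 't) plan)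
     \<Rightarrow> (nat \<Rightarrow> ('n, 't) plan) \<Rightarrow> nat \<Rightarrow> bool"
  where "ibdca_run P A x w y k \<longleftrightarrow>
    x 0 \<in> feasible \<and>
    (\<forall>i<k. ibdca_iteration P A (x (i - 1)) (x i) (w i) (y i) \<and>
           \<not> ibdca_stop A (w i) (y i) \<and>
           x (Suc i) = w i + line_search P A (w i) (y i) *\<^sub>R (y i - w i))"

definition ibdca_returns ::
    "('w, 'n::finite, 't::{finite,linorder}) portfolio \<Rightarrow> ibdca_params \<Rightarrow> (nat \<Rightarrow> ('n, 't) plan) \<Rightarrow> (nat \<Rightarrow> ('n, 't) plan)
     \<Rightarrow> (nat \<Rightarrow> ('n, 't) plan) \<Rightarrow> nat \<Rightarrow> ('n, 't) plan \<Rightarrow> bool"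
  where "ibdca_returns P A x w y k r \<longleftrightarrow>
    ibdca_run P A x w y k \<and>
    ibdca_iteration P A (x (k - 1)) (x k) (w k) (y k) \<and>
    ibdca_stop A (w k) (y k) \<and> r = w k"

definition ibdca_infinite ::
    "('w, 'n::finite, 't::{finite,linorder}) portfolio \<Rightarrow> ibdca_params \<Rightarrow> (nat \<Rightarrow> ('n, 't) plan) \<Rightarrow> (nat \<Rightarrow> ('n, 't) plan)
     \<Rightarrow> (nat \<Rightarrow> ('n, 't) plan) \<Rightarrow> bool"
  where "ibdca_infinite P A x w y \<longleftrightarrow> (\<forall>k. ibdca_run P A x w y k)"

end

theory Submission
  imports Defs
begin

text \<open>
  If \<open>v\<close> is the \<open>\<alpha>\<close>-quantile of the loss, then \<open>P(L < v) \<le> \<alpha> - \<gamma>\<close> and \<open>P(L \<le> v) \<ge> \<alpha>\<close> by the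
  choice of \<open>\<gamma>\<close>, so \<open>v\<close> minimizes the CVaR functions of both levels. This yields the DC
  decomposition of \<open>\<Phi>\<close> and represents the CVaR as a maximum over finitely many dual vectors. When
  the maximizer at the accumulation point \<open>a\<close> is unique, \<open>H\<close> is therefore affine with slope \<open>h\<close> near
  \<open>a\<close>, and \<open>\<Phi>\<close> agrees there, up to a constant, with the strongly convex function
  \<open>K = G - h \<bullet> \<cdot>\<close>.

  No Kurdyka-Lojasiewicz argument is needed. The descent property forces the steps to tend to zero,
  so \<open>a\<close> is a fixed point of the proximal map of \<open>K\<close>, hence its minimizer over the feasible set.
  Quadratic growth of \<open>K\<close> traps the iterates near \<open>a\<close>. From then on \<open>y\<^sup>k\<close> is the proximal point
  of \<open>w\<^sup>k\<close>, and comparing it with \<open>w\<^sup>k + t (a - w\<^sup>k)\<close> for a fixed \<open>t\<close> contracts the gap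
  \<open>\<Phi> - \<Phi>(a)\<close> by a constant factor.
\<close>

section \<open>Minimizers of convex functions\<close>

lemma convex_on_chord:
  fixes f :: "'a::real_vector \<Rightarrow> real"
  assumes "convex_on C f" "x \<in> C" "y \<in> C" "0 \<le> t" "t \<le> 1"
  shows "f (x + t *\<^sub>R (y - x)) \<le> (1 - t) * f x + t * f y"
proof -
  have "f ((1 - t) *\<^sub>R x + t *\<^sub>R y) \<le> (1 - t) * f x + t * f y"
    using convex_onD[OF assms(1), of t x y] assms by simp
  moreover have "(1 - t) *\<^sub>R x + t *\<^sub>R y = x + t *\<^sub>R (y - x)"
    by (simp add: algebra_simps)
  ultimately show ?thesis by simp
qed

lemma chord_in_convex:
  fixes x :: "'a::real_vector"
  assumes "convex C" "x \<in> C" "y \<in> C" "0 \<le> t" "t \<le> 1"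
  shows "x + t *\<^sub>R (y - x) \<in> C"
proof -
  have "(1 - t) *\<^sub>R x + t *\<^sub>R y \<in> C" using convexD_alt[OF assms(1-3)] assms by simp
  moreover have "(1 - t) *\<^sub>R x + t *\<^sub>R y = x + t *\<^sub>R (y - x)"
    by (simp add: algebra_simps)
  ultimately show ?thesis by simp
qed

text \<open>Let \<open>t\<close> tend to 0 from the right. This closes the chord arguments below:
  after division by \<open>t\<close>, the second-order terms still carry a factor
  \<open>t\<close>.\<close>

lemma le_of_le_mult_small:
  fixes a b :: real
  assumes "\<And>t. 0 < t \<Longrightarrow> t < 1 \<Longrightarrow> a \<le> t * b"
  shows "a \<le> 0"
proof -
  have "((\<lambda>t. t * b) \<longlongrightarrow> 0 * b) (at_right 0)" by (intro tendsto_intros)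
  moreover have "eventually (\<lambda>t. a \<le> t * b) (at_right (0::real))"
    unfolding eventually_at_right[OF zero_less_one]
    by (rule exI[of _ 1]) (use assms in auto)
  ultimately show ?thesis
    using tendsto_lowerbound[of "\<lambda>t. t * b" 0 "at_right 0" a] by simp
qed

text \<open>Moving a fraction \<open>t\<close> from \<open>x\<close> towards \<open>z\<close>
  changes \<open>f\<close> by at most \<open>t * (f z - f x)\<close>, while the penalty is of order
  \<open>t\<close> squared and so disappears after division by \<open>t\<close>.\<close>

lemma proximal_fixed_point_minimizes:
  fixes f :: "'a::real_inner \<Rightarrow> real"
  assumes f: "convex_on C f" and x: "x \<in> C" and z: "z \<in> C"
    and min: "\<And>v. v \<in> C \<Longrightarrow> f x \<le> f v + c * (norm (v - x))\<^sup>2"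
  shows "f x \<le> f z"
proof -
  have C: "convex C" using f convex_on_imp_convex by blast
  have "f x - f z \<le> t * (c * (norm (z - x))\<^sup>2)" if t: "0 < t" "t < 1" for t
  proof -
    have "f x \<le> f (x + t *\<^sub>R (z - x)) + c * (norm (t *\<^sub>R (z - x)))\<^sup>2"
      using min[OF chord_in_convex[OF C x z, of t]] t by simp
    also have "\<dots> \<le> (1 - t) * f x + t * f z + c * (norm (t *\<^sub>R (z - x)))\<^sup>2"
      using convex_on_chord[OF f x z, of t] t by simp
    also have "(norm (t *\<^sub>R (z - x)))\<^sup>2 = t\<^sup>2 * (norm (z - x))\<^sup>2"
      using t by (simp add: power_mult_distrib)
    finally have "t * (f x - f z) \<le> t * (t * (c * (norm (z - x))\<^sup>2))"
      by (simp add: algebra_simps power2_eq_square)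
    then show ?thesis using t by simp
  qed
  from le_of_le_mult_small[OF this] show ?thesis by simp
qed

lemma norm_sq_chord:
  fixes x y :: "'a::real_inner"
  shows "(norm (x + t *\<^sub>R (y - x)))\<^sup>2
    = (1 - t) * (norm x)\<^sup>2 + t * (norm y)\<^sup>2 - t * (1 - t) * (norm (y - x))\<^sup>2"
  unfolding power2_norm_eq_inner
  by (simp add: inner_add_left inner_add_right inner_diff_left inner_diff_right
      inner_commute algebra_simps power2_eq_square)

lemma convex_on_norm_sq: "convex_on UNIV (\<lambda>v :: 'a::real_inner. (norm v)\<^sup>2)"
proof (rule convex_onI)
  fix t :: real and v z :: 'a assume t: "0 < t" "t < 1"
  have "(1 - t) *\<^sub>R v + t *\<^sub>R z = v + t *\<^sub>R (z - v)" by (simp add: algebra_simps)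
  then show "(norm ((1 - t) *\<^sub>R v + t *\<^sub>R z))\<^sup>2 \<le> (1 - t) * (norm v)\<^sup>2 + t * (norm z)\<^sup>2"
    using t by (simp add: norm_sq_chord)
qed simp

text \<open>On the chord from \<open>y\<close> to \<open>z\<close> the identity
  \<open>norm_sq_chord\<close> leaves the surplus
  \<open>t * (1 - t) * c * (norm (z - y))\<^sup>2\<close>. Divided by \<open>t\<close>, it tends to
  the full growth term as \<open>t\<close> tends to 0.\<close>

lemma strongly_convex_minimizer_growth:
  fixes f :: "'a::real_inner \<Rightarrow> real"
  assumes f: "convex_on C f" and y: "y \<in> C" and z: "z \<in> C"
    and min: "\<And>v. v \<in> C \<Longrightarrow> f y + c * (norm y)\<^sup>2 \<le> f v + c * (norm v)\<^sup>2"
  shows "f y + c * (norm y)\<^sup>2 + c * (norm (z - y))\<^sup>2 \<le> f z + c * (norm z)\<^sup>2"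
proof -
  have C: "convex C" using f convex_on_imp_convex by blast
  have "(f y + c * (norm y)\<^sup>2 + c * (norm (z - y))\<^sup>2) - (f z + c * (norm z)\<^sup>2)
      \<le> t * (c * (norm (z - y))\<^sup>2)" if t: "0 < t" "t < 1" for t
  proof -
    have "f y + c * (norm y)\<^sup>2 \<le> f (y + t *\<^sub>R (z - y)) + c * (norm (y + t *\<^sub>R (z - y)))\<^sup>2"
      using min[OF chord_in_convex[OF C y z, of t]] t by simp
    also have "\<dots> \<le> (1 - t) * f y + t * f z + c * (norm (y + t *\<^sub>R (z - y)))\<^sup>2"
      using convex_on_chord[OF f y z, of t] t by simp
    finally have "t * ((f y + c * (norm y)\<^sup>2 + c * (norm (z - y))\<^sup>2) - (f z + c * (norm z)\<^sup>2))
      \<le> t * (t * (c * (norm (z - y))\<^sup>2))"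
      unfolding norm_sq_chord by (simp add: algebra_simps)
    then show ?thesis using t by simp
  qed
  from le_of_le_mult_small[OF this] show ?thesis by simp
qed

text \<open>Hahn-Banach: minimality makes the strict epigraph of \<open>G\<close> disjoint from
  \<open>C \<times> {..G x}\<close>. A separating hyperplane passes through \<open>(x, G x)\<close>
  and is not vertical; its slope is a subgradient, and the negative slope is normal to
  \<open>C\<close>.\<close>

lemma convex_minimizer_subgradient:
  fixes G :: "'a::euclidean_space \<Rightarrow> real"
  assumes G: "convex_on UNIV G" and C: "convex C" and x: "x \<in> C"
    and min: "\<And>y. y \<in> C \<Longrightarrow> G x \<le> G y"
  shows "\<exists>a. a \<in> subdifferential G x \<and> - a \<in> normal_cone C x"
proof -
  define U where "U = {(v, r). G v < r}"
  define W where "W = C \<times> {..G x}"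
  have "convex U"
  proof (rule convexI)
    fix p q :: "'a \<times> real" and a b :: real
    assume *: "p \<in> U" "q \<in> U" "0 \<le> a" "0 \<le> b" "a + b = 1"
    obtain v r v' r' where pq: "p = (v, r)" "q = (v', r')" by fastforce
    have lt: "G v < r" "G v' < r'" using * by (auto simp: pq U_def)
    have "G (a *\<^sub>R v + b *\<^sub>R v') \<le> a * G v + b * G v'"
      using G * unfolding convex_on_def by auto
    also have "\<dots> < a * r + b * r'"
    proof (cases "a = 0")
      case True then show ?thesis using lt * by simp
    next
      case False
      then show ?thesis
        using lt * by (intro add_less_le_mono mult_strict_left_mono mult_left_mono) auto
    qed
    finally show "a *\<^sub>R p + b *\<^sub>R q \<in> U" by (simp add: pq U_def)
  qed
  moreover have "convex W" unfolding W_def by (intro convex_Times C) auto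
  moreover have "U \<noteq> {}" using x by (auto simp: U_def intro!: exI[of _ x] exI[of _ "G x + 1"])
  moreover have "W \<noteq> {}" using x by (auto simp: W_def)
  moreover have "U \<inter> W = {}" using min by (fastforce simp: U_def W_def)
  ultimately obtain p c where p: "p \<noteq> 0" "\<forall>q\<in>U. p \<bullet> q \<le> c" "\<forall>q\<in>W. c \<le> p \<bullet> q"
    using separating_hyperplane_sets[of U W] by blast
  obtain a b where ab: "p = (a, b)" by fastforce
  have U1: "a \<bullet> v + b * r \<le> c" if "G v < r" for v r
    using p(2) that by (auto simp: ab U_def)
  have W1: "c \<le> a \<bullet> v + b * r" if "v \<in> C" "r \<le> G x" for v r
    using p(3) that by (auto simp: ab W_def)
  \<comment> \<open>Separation is known strictly above the graph only; raising the point by a small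
    \<open>d\<close> carries it to the graph itself. The sign of \<open>b\<close> is still open,
    hence the bound through \<open>\<bar>b\<bar> + 1\<close>.\<close>
  have U2: "a \<bullet> v + b * G v \<le> c" for v
  proof (rule field_le_epsilon)
    fix e :: real assume e: "0 < e"
    define d where "d = e / (\<bar>b\<bar> + 1)"
    have d: "0 < d" unfolding d_def using e by simp
    have "\<bar>b\<bar> * d \<le> (\<bar>b\<bar> + 1) * d" using d by (intro mult_right_mono) auto
    also have "\<dots> = e" by (simp add: d_def)
    finally have "\<bar>b * d\<bar> \<le> e" using d by (simp add: abs_mult)
    moreover have "a \<bullet> v + b * (G v + d) \<le> c" using U1[of v "G v + d"] d by simp
    ultimately show "a \<bullet> v + b * G v \<le> c + e" by (simp add: algebra_simps abs_le_iff)
  qed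
  have c: "c = a \<bullet> x + b * G x" using U2[of x] W1[OF x, of "G x"] by simp
  have "b \<le> 0" using U1[of x "G x + 1"] c by (simp add: algebra_simps)
  \<comment> \<open>If \<open>b = 0\<close>, the functional \<open>a\<close> is bounded above on the
    whole space; the test point \<open>x + a\<close> then forces \<open>a = 0\<close>.\<close>
  moreover have "b \<noteq> 0"
  proof
    assume b: "b = 0"
    have "a \<bullet> (x + a) \<le> a \<bullet> x" using U2[of "x + a"] c b by simp
    then have "a \<bullet> a \<le> 0" by (simp add: inner_add_right)
    then have "a = 0" by (metis inner_gt_zero_iff not_le)
    then show False using b p(1) ab by (simp add: zero_prod_def)
  qed
  ultimately have b: "b < 0" by simp
  \<comment> \<open>Division by \<open>- b > 0\<close> turns \<open>U2\<close> into the subgradient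
    inequality and \<open>W1\<close> into the normal cone inequality.\<close>
  define g where "g = (1 / - b) *\<^sub>R a"
  have ag: "a \<bullet> v = - b * (g \<bullet> v)" for v using b by (simp add: g_def)
  have "g \<in> subdifferential G x"
  proof -
    have "G x + g \<bullet> (v - x) \<le> G v" for v
    proof -
      have "- b * (G x + g \<bullet> (v - x)) \<le> - b * G v"
        using U2[of v] unfolding c ag by (simp add: inner_diff_right algebra_simps)
      then show ?thesis using b by simp
    qed
    then show ?thesis by (simp add: subdifferential_def)
  qed
  moreover have "- g \<in> normal_cone C x"
  proof -
    have "- g \<bullet> (v - x) \<le> 0" if "v \<in> C" for v
    proof -
      have "0 \<le> - b * (g \<bullet> (v - x))"
        using W1[OF that, of "G x"] unfolding c ag by (simp add: inner_diff_right algebra_simps)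
      then show ?thesis using b by (simp add: mult_le_0_iff)
    qed
    then show ?thesis by (simp add: normal_cone_def)
  qed
  ultimately show ?thesis by blast
qed

lemma convex_on_diff_linear:
  fixes G :: "'a::real_inner \<Rightarrow> real"
  assumes "convex_on C G"
  shows "convex_on C (\<lambda>v. G v - s \<bullet> v)"
proof -
  have "convex_on C (\<lambda>v. (- s) \<bullet> v)"
    using convex_on_imp_convex[OF assms]
    by (simp add: convex_on_def inner_add_right del: inner_minus_left)
  from convex_on_add[OF assms this] show ?thesis by simp
qed

text \<open>The optimality condition for the tilted function gives a subgradient \<open>a\<close>
  with \<open>- a\<close> normal. Undoing the tilt makes \<open>a + s\<close> a subgradient of
  \<open>G\<close>, and adding \<open>- a\<close> returns \<open>s\<close>.\<close>

lemma dc_critical_of_linearized_minimizer: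
  fixes G H :: "'a::euclidean_space \<Rightarrow> real"
  assumes G: "convex_on UNIV G" and C: "convex C" and x: "x \<in> C"
    and s: "s \<in> subdifferential H x"
    and min: "\<And>y. y \<in> C \<Longrightarrow> G x - s \<bullet> x \<le> G y - s \<bullet> y"
  shows "dc_critical C G H x"
proof -
  have "convex_on UNIV (\<lambda>v. G v - s \<bullet> v)"
    by (rule convex_on_diff_linear[OF G])
  from convex_minimizer_subgradient[OF this C x min]
  obtain a where a: "a \<in> subdifferential (\<lambda>v. G v - s \<bullet> v) x" "- a \<in> normal_cone C x" by blast
  have "a + s \<in> subdifferential G x"
    using a(1) by (simp add: subdifferential_def inner_diff_right inner_add_left algebra_simps)
  then have "s \<in> {a + b | a b. a \<in> subdifferential G x \<and> b \<in> normal_cone C x}"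
    using a(2) by (intro CollectI exI[of _ "a + s"] exI[of _ "- a"]) auto
  then show ?thesis using x s unfolding dc_critical_def by blast
qed

text \<open>Completing the square: the linearized subproblem is a proximal step for \<open>G - s \<bullet>\<close> at \<open>w\<close>.\<close>
lemma proximal_form:
  fixes w v s :: "'a::real_inner"
  shows "\<nu> / 2 * (norm v)\<^sup>2 - (s + \<nu> *\<^sub>R w) \<bullet> v
    = \<nu> / 2 * (norm (v - w))\<^sup>2 - s \<bullet> v - \<nu> / 2 * (norm w)\<^sup>2"
  unfolding power2_norm_eq_inner
  by (simp add: inner_add_left inner_diff_left inner_diff_right inner_commute algebra_simps)

text \<open>In the direction \<open>s - h\<close> the function grows exactly at the rate
  \<open>h \<bullet> (s - h)\<close>, and the subgradient inequality demands at least
  \<open>s \<bullet> (s - h)\<close>.\<close>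

lemma subdifferential_of_locally_affine:
  fixes H :: "'a::real_inner \<Rightarrow> real"
  assumes aff: "\<And>z. z \<in> ball a r \<Longrightarrow> H z = H a + h \<bullet> (z - a)" and w: "w \<in> ball a r"
    and s: "s \<in> subdifferential H w"
  shows "s = h"
proof -
  obtain e where e: "e > 0" "ball w e \<subseteq> ball a r"
    using w open_ball open_contains_ball by metis
  \<comment> \<open>This length keeps the displaced point in the ball of radius \<open>e\<close>
    about \<open>w\<close>; the summand 1 avoids division by zero when \<open>s = h\<close>.\<close>
  define t where "t = e / (2 * (norm (s - h) + 1))"
  have t: "t > 0" unfolding t_def using e
    by (intro divide_pos_pos mult_pos_pos add_nonneg_pos) auto
  have n: "norm (s - h) + 1 > 0" by (simp add: add_nonneg_pos)
  have "t * norm (s - h) < t * (2 * (norm (s - h) + 1))"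
    using t n by (intro mult_strict_left_mono) auto
  also have "\<dots> = e" unfolding t_def using n by simp
  finally have "w + t *\<^sub>R (s - h) \<in> ball a r" using e t by (intro subsetD[OF e(2)]) (simp add: dist_norm)
  from aff[OF this] aff[OF w]
  have "H (w + t *\<^sub>R (s - h)) = H w + t * (h \<bullet> (s - h))"
    by (simp add: inner_diff_right inner_add_right algebra_simps)
  moreover have "H (w + t *\<^sub>R (s - h)) \<ge> H w + s \<bullet> (t *\<^sub>R (s - h))"
    using s unfolding subdifferential_def
    by (metis (mono_tags, lifting) add_diff_cancel_left' mem_Collect_eq)
  ultimately have "t * ((s - h) \<bullet> (s - h)) \<le> 0" by (simp add: inner_diff_left algebra_simps)
  then have "(s - h) \<bullet> (s - h) \<le> 0" using t by (simp add: mult_le_0_iff)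
  then have "s - h = 0" by (metis inner_gt_zero_iff not_le)
  then show ?thesis by simp
qed

text \<open>Once the errors are below \<open>\<epsilon> * (1 - \<theta>) / 2\<close>, the value
  \<open>\<epsilon> / 2\<close> is a fixed point of the bounding recursion, and the excess over it
  decays like a power of \<open>\<theta>\<close>.\<close>

lemma contracting_recursion_tendsto_0:
  fixes a e :: "nat \<Rightarrow> real"
  assumes rec: "\<And>k. a (Suc k) \<le> \<theta> * a k + e k" and a: "\<And>k. 0 \<le> a k"
    and e: "e \<longlonglongrightarrow> 0" and \<theta>: "0 \<le> \<theta>" "\<theta> < 1"
  shows "a \<longlonglongrightarrow> 0"
proof (rule LIMSEQ_I)
  fix \<epsilon> :: real assume \<epsilon>: "0 < \<epsilon>"
  have "eventually (\<lambda>k. e k < \<epsilon> * (1 - \<theta>) / 2) sequentially"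
    using e \<epsilon> \<theta> by (intro order_tendstoD) auto
  then obtain N where N: "\<And>k. k \<ge> N \<Longrightarrow> e k < \<epsilon> * (1 - \<theta>) / 2"
    by (auto simp: eventually_sequentially)
  have bound: "a (N + m) \<le> \<theta> ^ m * a N + \<epsilon> / 2" for m
  proof (induction m)
    case 0 then show ?case using \<epsilon> by simp
  next
    case (Suc m)
    have "a (N + Suc m) \<le> \<theta> * a (N + m) + e (N + m)" using rec by simp
    also have "\<dots> \<le> \<theta> * (\<theta> ^ m * a N + \<epsilon> / 2) + \<epsilon> * (1 - \<theta>) / 2"
      using Suc N[of "N + m"] \<theta> by (intro add_mono mult_left_mono) auto
    also have "\<dots> = \<theta> ^ Suc m * a N + \<epsilon> / 2" by (simp add: field_simps)
    finally show ?case .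
  qed
  have "(\<lambda>m. \<theta> ^ m * a N) \<longlonglongrightarrow> 0 * a N"
    using \<theta> by (intro tendsto_intros LIMSEQ_power_zero) auto
  then have "eventually (\<lambda>m. \<theta> ^ m * a N < \<epsilon> / 2) sequentially"
    using \<epsilon> by (intro order_tendstoD) auto
  then obtain M where M: "\<And>m. m \<ge> M \<Longrightarrow> \<theta> ^ m * a N < \<epsilon> / 2"
    by (auto simp: eventually_sequentially)
  have "norm (a k - 0) < \<epsilon>" if "k \<ge> N + M" for k
  proof -
    have "a k < \<epsilon>" using bound[of "k - N"] M[of "k - N"] that by fastforce
    then show ?thesis using a[of k] by simp
  qed
  then show "\<exists>no. \<forall>k\<ge>no. norm (a k - 0) < \<epsilon>" by blast
qed


section \<open>Inertial DC iterations near points where the subtracted function is affine\<close>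

lemma eventually_in_ball_of_tendsto:
  fixes f :: "nat \<Rightarrow> 'a::metric_space"
  assumes "f \<longlonglongrightarrow> a" "0 < r"
  shows "eventually (\<lambda>k. f k \<in> ball a r) sequentially"
  using tendstoD[OF assms] by (simp add: dist_commute)

lemma norm_tendsto_0_of_sq_le:
  fixes f :: "nat \<Rightarrow> 'a::real_normed_vector" and g :: "nat \<Rightarrow> real"
  assumes g: "g \<longlonglongrightarrow> 0" and le: "eventually (\<lambda>k. (norm (f k))\<^sup>2 \<le> g k) sequentially"
  shows "(\<lambda>k. norm (f k)) \<longlonglongrightarrow> 0"
proof -
  have "(\<lambda>k. (norm (f k))\<^sup>2) \<longlonglongrightarrow> 0"
    by (rule tendsto_sandwich[OF _ le tendsto_const g]) simp
  from tendsto_real_sqrt[OF this] show ?thesis by simp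
qed

text \<open>Isolates what the convergence argument uses of the algorithm. \<open>y_min\<close> is
  the subproblem in proximal form, \<open>d_le\<close> records a step length of at least 1, and
  \<open>F_y\<close> and \<open>descent\<close> are the acceptance conditions of the line search.
  The splitting of \<open>G\<close> into \<open>Gc\<close> and a square makes strong convexity
  explicit.\<close>

locale inertial_dc_iteration =
  fixes C :: "'a::euclidean_space set"
    and Gc G H F :: "'a \<Rightarrow> real"
    and lam \<theta> \<nu> \<sigma> :: real
    and x w y s :: "nat \<Rightarrow> 'a"
  assumes C: "convex C" "closed C"
    and Gc: "convex_on UNIV Gc"
    and G: "\<And>v. G v = Gc v + lam * (norm v)\<^sup>2"
    and H: "convex_on UNIV H"
    and F: "\<And>v. F v = G v - H v"
    and pars: "0 < lam" "0 \<le> \<theta>" "\<theta> < 1" "0 < \<nu>" "0 < \<sigma>"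
    and xC: "\<And>k. x k \<in> C" and wC: "\<And>k. w k \<in> C" and yC: "\<And>k. y k \<in> C"
    and inertia: "\<And>k. norm (w k - x k) \<le> \<theta> * norm (x k - x (k - 1))"
    and F_w: "\<And>k. F (w k) \<le> F (x k)"
    and s: "\<And>k. s k \<in> subdifferential H (w k)"
    and y_min: "\<And>k v. v \<in> C \<Longrightarrow>
      G (y k) - s k \<bullet> y k + \<nu> / 2 * (norm (y k - w k))\<^sup>2
        \<le> G v - s k \<bullet> v + \<nu> / 2 * (norm (v - w k))\<^sup>2"
    and d_le: "\<And>k. norm (y k - w k) \<le> norm (x (Suc k) - w k)"
    and F_y: "\<And>k. F (x (Suc k)) \<le> F (y k)"
    and descent: "\<And>k. F (x (Suc k)) \<le> F (w k) - \<sigma> * (norm (x (Suc k) - w k))\<^sup>2"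
begin

lemma G_convex: "convex_on UNIV G"
proof -
  have "convex_on UNIV (\<lambda>v :: 'a. lam * (norm v)\<^sup>2)"
    using pars by (intro convex_on_cmul convex_on_norm_sq) simp
  from convex_on_add[OF Gc this] show ?thesis by (simp add: G[abs_def])
qed

lemma isCont_GF: "isCont G z" "isCont F z"
proof -
  have "continuous_on UNIV G" "continuous_on UNIV H"
    using convex_on_continuous[OF open_UNIV] G_convex H by blast+
  then have *: "isCont G z" "isCont H z" by (simp_all add: continuous_on_eq_continuous_at)
  then show "isCont G z" by blast
  show "isCont F z" unfolding F[abs_def] using * by (intro continuous_intros)
qed

lemma F_x_le: "F (x (Suc k)) \<le> F (x k)"
  using descent[of k] F_w[of k] pars by (smt (verit) mult_nonneg_nonneg zero_le_power2)

lemma F_x_antimono: "i \<le> j \<Longrightarrow> F (x j) \<le> F (x i)"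
  using F_x_le by (rule lift_Suc_antimono_le)

section \<open>Local analysis at an accumulation point near which \<open>H\<close> is affine\<close>

context
  fixes \<phi> :: "nat \<Rightarrow> nat" and a h :: 'a and r :: real
  assumes \<phi>: "strict_mono \<phi>" "(x \<circ> \<phi>) \<longlonglongrightarrow> a"
    and r: "r > 0" and affine: "\<And>z. z \<in> ball a r \<Longrightarrow> H z = H a + h \<bullet> (z - a)"
begin

lemma a_in_C: "a \<in> C"
  using closed_sequentially[OF C(2) _ \<phi>(2)] xC by simp

text \<open>The values decrease, and by continuity they tend to \<open>F a\<close> along the
  subsequence.\<close>

lemma F_x_tendsto: "(\<lambda>k. F (x k)) \<longlonglongrightarrow> F a"
proof (rule LIMSEQ_I)
  have sub: "(\<lambda>k. F ((x \<circ> \<phi>) k)) \<longlonglongrightarrow> F a"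
    using isCont_tendsto_compose[OF isCont_GF(2) \<phi>(2)] .
  have ge: "F a \<le> F (x k)" for k
  proof (rule LIMSEQ_le_const2[OF sub])
    have "F ((x \<circ> \<phi>) n) \<le> F (x k)" if "n \<ge> k" for n
      using F_x_antimono[of k "\<phi> n"] seq_suble[OF \<phi>(1), of n] that by simp
    then show "\<exists>N. \<forall>n\<ge>N. F ((x \<circ> \<phi>) n) \<le> F (x k)" by blast
  qed
  fix e :: real assume "0 < e"
  then have "eventually (\<lambda>k. F ((x \<circ> \<phi>) k) < F a + e) sequentially"
    using sub by (intro order_tendstoD) auto
  then obtain m where m: "F ((x \<circ> \<phi>) m) < F a + e" by (auto simp: eventually_sequentially)
  have "norm (F (x n) - F a) < e" if "n \<ge> \<phi> m" for n
    using F_x_antimono[OF that] m ge[of n] by simp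
  then show "\<exists>no. \<forall>n\<ge>no. norm (F (x n) - F a) < e" by blast
qed

lemma F_ge_a: "F a \<le> F (x k)"
  using decseq_ge[OF _ F_x_tendsto] F_x_antimono by (simp add: decseq_def)

text \<open>By \<open>descent\<close> the squared step is at most a multiple of the difference of
  consecutive values, and these values converge.\<close>

lemma step_from_w_tendsto: "(\<lambda>k. norm (x (Suc k) - w k)) \<longlonglongrightarrow> 0"
proof -
  have "(\<lambda>k. (F (x k) - F (x (Suc k))) / \<sigma>) \<longlonglongrightarrow> (F a - F a) / \<sigma>"
    using pars by (intro tendsto_intros F_x_tendsto LIMSEQ_Suc[OF F_x_tendsto]) simp
  then have "(\<lambda>k. (F (x k) - F (x (Suc k))) / \<sigma>) \<longlonglongrightarrow> 0" by simp
  moreover have "(norm (x (Suc k) - w k))\<^sup>2 \<le> (F (x k) - F (x (Suc k))) / \<sigma>" for k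
    using descent[of k] F_w[of k] pars by (simp add: field_simps)
  ultimately show ?thesis by (intro norm_tendsto_0_of_sq_le) auto
qed

text \<open>The inertial displacement is at most \<open>\<theta>\<close> times the preceding step,
  so the step lengths obey a contracting recursion with vanishing error.\<close>

lemma step_tendsto: "(\<lambda>k. norm (x (Suc k) - x k)) \<longlonglongrightarrow> 0"
proof (rule contracting_recursion_tendsto_0)
  show "norm (x (Suc (Suc k)) - x (Suc k))
      \<le> \<theta> * norm (x (Suc k) - x k) + norm (x (Suc (Suc k)) - w (Suc k))" for k
    using inertia[of "Suc k"]
      norm_triangle_ineq[of "x (Suc (Suc k)) - w (Suc k)" "w (Suc k) - x (Suc k)"] by simp
  show "(\<lambda>k. norm (x (Suc (Suc k)) - w (Suc k))) \<longlonglongrightarrow> 0"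
    using LIMSEQ_Suc[OF step_from_w_tendsto] .
qed (use pars in auto)

lemma w_minus_x_tendsto: "(\<lambda>k. w k - x k) \<longlonglongrightarrow> 0"
proof (rule Lim_null_comparison)
  have "(\<lambda>k. norm (x (Suc k) - x (Suc k - 1))) \<longlonglongrightarrow> 0" using step_tendsto by simp
  then have "(\<lambda>k. norm (x k - x (k - 1))) \<longlonglongrightarrow> 0"
    by (subst filterlim_sequentially_Suc[symmetric]) simp
  from tendsto_mult_right_zero[OF this]
  show "(\<lambda>k. \<theta> * norm (x k - x (k - 1))) \<longlonglongrightarrow> 0" .
qed (use inertia in auto)

lemma y_minus_w_tendsto: "(\<lambda>k. y k - w k) \<longlonglongrightarrow> 0"
  by (rule Lim_null_comparison[OF _ step_from_w_tendsto]) (use d_le in auto)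

lemma s_eq: "w k \<in> ball a r \<Longrightarrow> s k = h"
  using subdifferential_of_locally_affine[OF affine _ s] by blast

text \<open>Some \<open>w (\<phi> k)\<close> lies in the ball, where the subgradient chosen by the
  algorithm must be \<open>h\<close>. The affine minorant of \<open>H\<close> based there coincides
  with the one based at \<open>a\<close>.\<close>

lemma h_subgradient: "h \<in> subdifferential H a"
proof -
  have wphi: "(\<lambda>k. w (\<phi> k)) \<longlonglongrightarrow> a"
  proof -
    have "(\<lambda>k. (w (\<phi> k) - x (\<phi> k)) + x (\<phi> k)) \<longlonglongrightarrow> 0 + a"
      using LIMSEQ_subseq_LIMSEQ[OF w_minus_x_tendsto \<phi>(1)] \<phi>(2)
      by (intro tendsto_add) (auto simp: o_def)
    then show ?thesis by simp
  qed
  then have "eventually (\<lambda>k. w (\<phi> k) \<in> ball a r) sequentially"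
    using r by (rule eventually_in_ball_of_tendsto)
  then obtain k where "w (\<phi> k) \<in> ball a r" by (auto simp: eventually_sequentially)
  then have w: "w (\<phi> k) \<in> ball a r" "h \<in> subdifferential H (w (\<phi> k))"
    using s_eq s by metis+
  have "H a + h \<bullet> (z - a) \<le> H z" for z
  proof -
    have "H (w (\<phi> k)) + h \<bullet> (z - w (\<phi> k)) \<le> H z" using w(2) by (simp add: subdifferential_def)
    then show ?thesis using affine[OF w(1)] by (simp add: inner_diff_right)
  qed
  then show ?thesis by (simp add: subdifferential_def)
qed

text \<open>Along the subsequence both \<open>w\<close> and \<open>y\<close> tend to
  \<open>a\<close>, and \<open>s\<close> is eventually \<open>h\<close>. The limit of
  \<open>y_min\<close> says that \<open>a\<close> is its own proximal point for a convex function,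
  hence a minimizer.\<close>

lemma a_minimizes:
  assumes v: "v \<in> C"
  shows "G a - h \<bullet> a \<le> G v - h \<bullet> v"
proof (rule proximal_fixed_point_minimizes[OF _ a_in_C v])
  show "convex_on C (\<lambda>v. G v - h \<bullet> v)"
    by (rule convex_on_diff_linear[OF convex_on_subset[OF G_convex subset_UNIV C(1)]])
  fix v assume v: "v \<in> C"
  have xphi: "(\<lambda>k. x (\<phi> k)) \<longlonglongrightarrow> a" using \<phi>(2) by (simp add: o_def)
  have wphi: "(\<lambda>k. w (\<phi> k)) \<longlonglongrightarrow> a"
    using tendsto_add[OF LIMSEQ_subseq_LIMSEQ[OF w_minus_x_tendsto \<phi>(1)] \<phi>(2)]
    by (simp add: o_def)
  have yphi: "(\<lambda>k. y (\<phi> k)) \<longlonglongrightarrow> a"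
    using tendsto_add[OF LIMSEQ_subseq_LIMSEQ[OF y_minus_w_tendsto \<phi>(1)] wphi]
    by (simp add: o_def)
  have "(\<lambda>k. G (y (\<phi> k)) - h \<bullet> y (\<phi> k) + \<nu> / 2 * (norm (y (\<phi> k) - w (\<phi> k)))\<^sup>2)
      \<longlonglongrightarrow> G a - h \<bullet> a + \<nu> / 2 * (norm (a - a))\<^sup>2"
    by (intro tendsto_intros isCont_tendsto_compose[OF isCont_GF(1)] yphi wphi)
  moreover have "(\<lambda>k. G v - h \<bullet> v + \<nu> / 2 * (norm (v - w (\<phi> k)))\<^sup>2)
      \<longlonglongrightarrow> G v - h \<bullet> v + \<nu> / 2 * (norm (v - a))\<^sup>2"
    by (intro tendsto_intros wphi)
  moreover have "eventually (\<lambda>k. G (y (\<phi> k)) - h \<bullet> y (\<phi> k)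
      + \<nu> / 2 * (norm (y (\<phi> k) - w (\<phi> k)))\<^sup>2
        \<le> G v - h \<bullet> v + \<nu> / 2 * (norm (v - w (\<phi> k)))\<^sup>2) sequentially"
  proof -
    have "eventually (\<lambda>k. w (\<phi> k) \<in> ball a r) sequentially"
      using wphi r by (rule eventually_in_ball_of_tendsto)
    then show ?thesis 
    proof eventually_elim
      case (elim k)
      then show ?case using y_min[OF v, of "\<phi> k"] s_eq by simp
    qed
  qed
  ultimately show "G a - h \<bullet> a \<le> G v - h \<bullet> v + \<nu> / 2 * (norm (v - a))\<^sup>2"
    using tendsto_le[OF sequentially_bot] by fastforce
qed

lemma a_critical: "dc_critical C G H a"
  by (rule dc_critical_of_linearized_minimizer[OF G_convex C(1) a_in_C h_subgradient a_minimizes])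

lemma F_eq: "z \<in> ball a r \<Longrightarrow> F z - F a = (G z - h \<bullet> z) - (G a - h \<bullet> a)"
  using affine[of z] by (simp add: F inner_diff_right)

text \<open>Holds on all of \<open>C\<close>, because \<open>H\<close> is replaced by its affine
  model; \<open>quadratic_growth\<close> transfers it to \<open>F\<close> inside the ball.\<close>

lemma linearized_growth:
  assumes "z \<in> C"
  shows "lam * (norm (z - a))\<^sup>2 \<le> (G z - h \<bullet> z) - (G a - h \<bullet> a)"
proof -
  have "convex_on C (\<lambda>v. Gc v - h \<bullet> v)"
    by (rule convex_on_diff_linear[OF convex_on_subset[OF Gc subset_UNIV C(1)]])
  from strongly_convex_minimizer_growth[OF this a_in_C assms, of lam] a_minimizes
  show ?thesis by (simp add: G algebra_simps)
qed

lemma quadratic_growth: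
  assumes "z \<in> C" "z \<in> ball a r"
  shows "lam * (norm (z - a))\<^sup>2 \<le> F z - F a"
  using linearized_growth[OF assms(1)] F_eq[OF assms(2)] by simp

text \<open>A trapping argument. From a point within \<open>r / 2\<close> of \<open>a\<close>, a
  step shorter than \<open>r / 2\<close> stays in the ball of radius \<open>r\<close>, where
  quadratic growth applies; since the value is below \<open>F a + lam * (r / 2)\<^sup>2\<close>, the
  new point is again within \<open>r / 2\<close>. Growth then turns convergence of values into
  convergence of iterates.\<close>

lemma x_tendsto: "x \<longlonglongrightarrow> a"
proof -
  have "eventually (\<lambda>k. norm (x (Suc k) - x k) < r / 2) sequentially"
    using step_tendsto r by (intro order_tendstoD) auto
  moreover have "eventually (\<lambda>k. F (x k) < F a + lam * (r / 2)\<^sup>2) sequentially"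
    using F_x_tendsto r pars by (intro order_tendstoD) auto
  ultimately have "eventually (\<lambda>k. norm (x (Suc k) - x k) < r / 2
      \<and> F (x k) < F a + lam * (r / 2)\<^sup>2) sequentially"
    by (rule eventually_conj)
  then obtain N where N: "\<And>k. k \<ge> N \<Longrightarrow> norm (x (Suc k) - x k) < r / 2"
      "\<And>k. k \<ge> N \<Longrightarrow> F (x k) < F a + lam * (r / 2)\<^sup>2"
    unfolding eventually_sequentially by blast
  have "eventually (\<lambda>k. (x \<circ> \<phi>) k \<in> ball a (r / 2)) sequentially"
    using eventually_in_ball_of_tendsto[OF \<phi>(2), of "r / 2"] r by simp
  then obtain m where "\<And>k. k \<ge> m \<Longrightarrow> (x \<circ> \<phi>) k \<in> ball a (r / 2)"
    unfolding eventually_sequentially by blast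
  then have M: "x (\<phi> (max m N)) \<in> ball a (r / 2)" "\<phi> (max m N) \<ge> N"
    using seq_suble[OF \<phi>(1), of "max m N"] by simp_all
  have trap: "norm (x k - a) < r / 2" if "k \<ge> \<phi> (max m N)" for k
    using that
  proof (induction k rule: dec_induct)
    case base
    then show ?case using M(1) by (simp add: dist_norm norm_minus_commute)
  next
    case (step k)
    have k: "k \<ge> N" using M(2) step by simp
    have "norm (x (Suc k) - a) \<le> norm (x (Suc k) - x k) + norm (x k - a)"
      using norm_triangle_ineq[of "x (Suc k) - x k" "x k - a"] by simp
    also have "\<dots> < r" using N(1)[OF k] step by simp
    finally have "x (Suc k) \<in> ball a r" by (simp add: dist_norm norm_minus_commute)
    then have "lam * (norm (x (Suc k) - a))\<^sup>2 \<le> F (x (Suc k)) - F a"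
      using quadratic_growth xC by blast
    also have "\<dots> < lam * (r / 2)\<^sup>2" using N(2)[of "Suc k"] k by simp
    finally have "(norm (x (Suc k) - a))\<^sup>2 < (r / 2)\<^sup>2" using pars by simp
    then show ?case by (rule power2_less_imp_less) (use r in auto)
  qed
  have "eventually (\<lambda>k. (norm (x k - a))\<^sup>2 \<le> (F (x k) - F a) / lam) sequentially"
  proof (rule eventually_sequentiallyI)
    fix k assume "k \<ge> \<phi> (max m N)"
    from trap[OF this] have "x k \<in> ball a r" using r by (simp add: dist_norm norm_minus_commute)
    from quadratic_growth[OF xC this] show "(norm (x k - a))\<^sup>2 \<le> (F (x k) - F a) / lam"
      using pars by (simp add: field_simps)
  qed
  moreover have "(\<lambda>k. (F (x k) - F a) / lam) \<longlonglongrightarrow> (F a - F a) / lam"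
    using pars by (intro tendsto_intros F_x_tendsto) simp
  ultimately have "(\<lambda>k. norm (x k - a)) \<longlonglongrightarrow> 0" by (intro norm_tendsto_0_of_sq_le) auto
  then have "(\<lambda>k. x k - a) \<longlonglongrightarrow> 0" by (simp add: tendsto_norm_zero_iff)
  then show ?thesis by (simp add: LIM_zero_iff)
qed

lemma gap_contraction:
  "\<exists>q. 0 < q \<and> q < 1 \<and> eventually (\<lambda>k. F (x (Suc k)) - F a \<le> q * (F (x k) - F a)) sequentially"
proof -
  define K where "K v = G v - h \<bullet> v" for v
  have K: "convex_on C K" unfolding K_def
    by (rule convex_on_diff_linear[OF convex_on_subset[OF G_convex subset_UNIV C(1)]])
  \<comment> \<open>The largest fraction of the chord with \<open>\<nu> * t \<le> lam\<close>. Then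
    the proximal penalty at the comparison point is at most half of the gain \<open>t * E\<close>,
    which gives the factor \<open>1 - t / 2\<close>.\<close>
  define t where "t = min 1 (lam / \<nu>)"
  have t: "0 < t" "t \<le> 1" "\<nu> * t \<le> lam" using pars by (auto simp: t_def min_def field_simps)
  have wlim: "w \<longlonglongrightarrow> a" using tendsto_add[OF w_minus_x_tendsto x_tendsto] by simp
  have ylim: "y \<longlonglongrightarrow> a" using tendsto_add[OF y_minus_w_tendsto wlim] by simp
  have "eventually (\<lambda>k. w k \<in> ball a r) sequentially" "eventually (\<lambda>k. y k \<in> ball a r) sequentially"
    using wlim ylim r by (blast intro: eventually_in_ball_of_tendsto)+
  then have "eventually (\<lambda>k. F (x (Suc k)) - F a \<le> (1 - t / 2) * (F (x k) - F a)) sequentially"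
  proof eventually_elim
    case (elim k)
    define D where "D = (norm (a - w k))\<^sup>2"
    define E where "E = K (w k) - K a"
    have E: "lam * D \<le> E" "0 \<le> D"
      using linearized_growth[OF wC, of k] by (simp_all add: E_def D_def K_def norm_minus_commute)
    have "K (y k) \<le> K (y k) + \<nu> / 2 * (norm (y k - w k))\<^sup>2" using pars by simp
    also have "\<dots> \<le> K (w k + t *\<^sub>R (a - w k)) + \<nu> / 2 * (norm (t *\<^sub>R (a - w k)))\<^sup>2"
      using y_min[OF chord_in_convex[OF C(1) wC[of k] a_in_C], of t k] t
      by (simp add: K_def s_eq[OF elim(1)])
    also have "K (w k + t *\<^sub>R (a - w k)) \<le> (1 - t) * K (w k) + t * K a"
      using convex_on_chord[OF K wC a_in_C] t by simp
    also have "(norm (t *\<^sub>R (a - w k)))\<^sup>2 = t\<^sup>2 * D"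
      using t by (simp add: D_def power_mult_distrib)
    finally have "K (y k) - K a \<le> (1 - t) * E + t / 2 * ((\<nu> * t) * D)"
      by (simp add: E_def algebra_simps power2_eq_square)
    also have "(\<nu> * t) * D \<le> lam * D" using t E by (intro mult_right_mono) auto
    then have "t / 2 * ((\<nu> * t) * D) \<le> t / 2 * E" using E t by (intro mult_left_mono) auto
    then have "(1 - t) * E + t / 2 * ((\<nu> * t) * D) \<le> (1 - t / 2) * E" by (simp add: algebra_simps)
    finally have "K (y k) - K a \<le> (1 - t / 2) * E" by simp
    \<comment> \<open>Both \<open>w k\<close> and \<open>y k\<close> lie in the ball, so the
      estimate for \<open>K\<close> is one for \<open>F\<close>. The passage from \<open>y k\<close>
      to the next iterate uses only \<open>F_y\<close>.\<close>
    then have "F (y k) - F a \<le> (1 - t / 2) * (F (w k) - F a)"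
      using F_eq[OF elim(1)] F_eq[OF elim(2)] by (simp add: K_def E_def)
    also have "\<dots> \<le> (1 - t / 2) * (F (x k) - F a)"
      using F_w[of k] t by (intro mult_left_mono) auto
    finally show ?case using F_y[of k] by simp
  qed
  then show ?thesis using t by (intro exI[of _ "1 - t / 2"]) auto
qed

text \<open>The gap decays like \<open>q ^ k\<close> and dominates the squared distance to
  \<open>a\<close>, so the distance decays at the rate \<open>sqrt q\<close>.\<close>

lemma linear_rate:
  "\<exists>C>0. \<exists>\<omega>. 0 < \<omega> \<and> \<omega> < 1 \<and> (\<exists>K::nat. \<forall>k\<ge>K. norm (x k - a) \<le> C * \<omega> ^ (k - K))"
proof -
  obtain q where q: "0 < q" "q < 1"
      and ev: "eventually (\<lambda>k. F (x (Suc k)) - F a \<le> q * (F (x k) - F a)) sequentially"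
    using gap_contraction by blast
  have "eventually (\<lambda>k. x k \<in> ball a r) sequentially"
    using x_tendsto r by (rule eventually_in_ball_of_tendsto)
  with ev have "eventually (\<lambda>k. F (x (Suc k)) - F a \<le> q * (F (x k) - F a) \<and> x k \<in> ball a r) sequentially"
    by (rule eventually_conj)
  then obtain K where K: "\<And>k. k \<ge> K \<Longrightarrow> F (x (Suc k)) - F a \<le> q * (F (x k) - F a)"
      "\<And>k. k \<ge> K \<Longrightarrow> x k \<in> ball a r"
    unfolding eventually_sequentially by blast
  define M where "M = (F (x K) - F a) / lam"
  have M: "M \<ge> 0" using F_ge_a[of K] pars by (simp add: M_def)
  have gap: "F (x k) - F a \<le> lam * M * q ^ (k - K)" if "k \<ge> K" for k
    using that
  proof (induction k rule: dec_induct)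
    case base then show ?case using pars by (simp add: M_def)
  next
    case (step k)
    have "F (x (Suc k)) - F a \<le> q * (F (x k) - F a)" using K step by simp
    also have "\<dots> \<le> q * (lam * M * q ^ (k - K))" using step q by (intro mult_left_mono) auto
    also have "\<dots> = lam * M * q ^ (Suc k - K)" using step by (simp add: Suc_diff_le)
    finally show ?case .
  qed
  \<comment> \<open>The summand 1 keeps the constant positive when the gap at \<open>K\<close> is
    zero.\<close>
  have "norm (x k - a) \<le> (sqrt M + 1) * sqrt q ^ (k - K)" if k: "k \<ge> K" for k
  proof -
    have "lam * (norm (x k - a))\<^sup>2 \<le> lam * (M * q ^ (k - K))"
      using quadratic_growth[OF xC K(2)[OF k]] gap[OF k] by simp
    then have "(norm (x k - a))\<^sup>2 \<le> M * q ^ (k - K)" using pars by simp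
    then have "norm (x k - a) \<le> sqrt (M * q ^ (k - K))" by (rule real_le_rsqrt)
    also have "\<dots> = sqrt M * sqrt q ^ (k - K)" by (simp add: real_sqrt_mult real_sqrt_power)
    also have "\<dots> \<le> (sqrt M + 1) * sqrt q ^ (k - K)" using q by (intro mult_right_mono) auto
    finally show ?thesis .
  qed
  moreover have "sqrt M + 1 > 0" using M by (intro add_nonneg_pos) auto
  moreover have "0 < sqrt q" "sqrt q < 1" using q by auto
  ultimately show ?thesis by blast
qed

lemma finite_length: "summable (\<lambda>k. norm (x (Suc k) - x k))"
proof -
  obtain C \<omega> and K :: nat where C: "C > 0" "0 < \<omega>" "\<omega> < 1"
      and le: "\<And>k. k \<ge> K \<Longrightarrow> norm (x k - a) \<le> C * \<omega> ^ (k - K)"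
    using linear_rate by blast
  have bound: "norm (norm (x (Suc (k + K)) - x (k + K))) \<le> 2 * C * \<omega> ^ k" for k
  proof -
    have "norm (x (Suc (k + K)) - x (k + K)) \<le> norm (x (Suc (k + K)) - a) + norm (x (k + K) - a)"
      using norm_triangle_ineq4[of "x (Suc (k + K)) - a" "x (k + K) - a"] by simp
    also have "\<dots> \<le> C * \<omega> ^ Suc k + C * \<omega> ^ k"
      using le[of "Suc (k + K)"] le[of "k + K"] by (intro add_mono) (simp_all add: Suc_diff_le)
    also have "\<dots> \<le> C * \<omega> ^ k + C * \<omega> ^ k"
      using C by (intro add_mono mult_left_mono) (auto simp: mult_left_le_one_le)
    finally show ?thesis by simp
  qed
  have "summable (\<lambda>k. 2 * C * \<omega> ^ k)"
    using C by (intro summable_mult summable_geometric) auto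
  then have "summable (\<lambda>k. norm (x (Suc (k + K)) - x (k + K)))"
    by (rule summable_comparison_test'[where N = 0]) (rule bound)
  then show ?thesis using summable_iff_shift[of "\<lambda>k. norm (x (Suc k) - x k)" K] by simp
qed

end

end


section \<open>Quantiles and tail expectations of finite distributions\<close>

text \<open>The quantile is the least attained loss whose cumulative weight reaches
  \<open>\<alpha>\<close>, so the infimum defining the value at risk is attained.\<close>

lemma finite_quantile_exists:
  fixes p L :: "'j \<Rightarrow> real"
  assumes S: "finite S" and p1: "(\<Sum>j\<in>S. p j) = 1" and \<alpha>: "0 < \<alpha>" "\<alpha> \<le> 1"
  shows "\<exists>v. \<alpha> \<le> (\<Sum>j | j \<in> S \<and> L j \<le> v. p j) \<and> (\<Sum>j | j \<in> S \<and> L j < v. p j) < \<alpha>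
    \<and> (\<forall>u. \<alpha> \<le> (\<Sum>j | j \<in> S \<and> L j \<le> u. p j) \<longrightarrow> v \<le> u)"
proof -
  define W where "W u = (\<Sum>j | j \<in> S \<and> L j \<le> u. p j)" for u
  define N where "N = {l \<in> L ` S. \<alpha> \<le> W l}"
  have N: "finite N" unfolding N_def using S by simp
  \<comment> \<open>A downward closed set of scenarios equals the sublevel set of its largest loss;
    if its mass reaches \<open>\<alpha>\<close>, that loss belongs to \<open>N\<close>. Applied to
    all scenarios, to those strictly below \<open>v\<close>, and to those up to
    \<open>u\<close>.\<close>
  have below: "\<exists>l\<in>N. l \<in> L ` I" if "I \<subseteq> S" "\<alpha> \<le> (\<Sum>j\<in>I. p j)"
      "\<And>i j. i \<in> I \<Longrightarrow> j \<in> S \<Longrightarrow> L j \<le> L i \<Longrightarrow> j \<in> I" for I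
  proof -
    have fI: "finite I" using that(1) S finite_subset by blast
    have ne: "I \<noteq> {}" using that(2) \<alpha> by auto
    have m: "Max (L ` I) \<in> L ` I" using fI ne by simp
    obtain i where i: "i \<in> I" "Max (L ` I) = L i" using m by blast
    have "L j \<le> Max (L ` I)" if "j \<in> I" for j using fI that by simp
    then have "{j. j \<in> S \<and> L j \<le> Max (L ` I)} = I"
      using that(1) that(3)[OF i(1)] i(2) by auto
    then have "W (Max (L ` I)) = (\<Sum>j\<in>I. p j)" by (simp add: W_def)
    then have "Max (L ` I) \<in> N" using that m by (auto simp: N_def)
    then show ?thesis using m by blast
  qed
  have "N \<noteq> {}" using below[of S] p1 \<alpha> by auto
  define v where "v = Min N"
  have vN: "v \<in> N" using N \<open>N \<noteq> {}\<close> by (simp add: v_def)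
  have vle: "v \<le> l" if "l \<in> N" for l using N that by (simp add: v_def)
  have "(\<Sum>j | j \<in> S \<and> L j < v. p j) < \<alpha>"
  proof (rule ccontr)
    assume "\<not> ?thesis"
    then obtain l where "l \<in> N" "l \<in> L ` {j. j \<in> S \<and> L j < v}"
      using below[of "{j. j \<in> S \<and> L j < v}"] by force
    then show False using vle[of l] by auto
  qed
  moreover have "v \<le> u" if "\<alpha> \<le> W u" for u
  proof -
    have "\<exists>l\<in>N. l \<in> L ` {j. j \<in> S \<and> L j \<le> u}"
      by (rule below) (use that in \<open>auto simp: W_def\<close>)
    then show ?thesis using vle by force
  qed
  moreover have "\<alpha> \<le> W v" using vN by (simp add: N_def)
  ultimately show ?thesis unfolding W_def by blast
qed

text \<open>Scenario by scenario \<open>th j * L j\<close> equals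
  \<open>max (L j - v) 0 + v * th j\<close>; at a tie this holds for any value of
  \<open>th j\<close>, so ties enter only through the total mass.\<close>

lemma tail_expectation_eq:
  fixes p L th :: "'j \<Rightarrow> real"
  assumes S: "finite S" and \<beta>: "\<beta> < 1"
    and th: "\<And>j. j \<in> S \<Longrightarrow> L j > v \<Longrightarrow> th j = 1" "\<And>j. j \<in> S \<Longrightarrow> L j < v \<Longrightarrow> th j = 0"
    and sum: "(\<Sum>j\<in>S. p j * th j) = 1 - \<beta>"
  shows "(\<Sum>j\<in>S. p j * th j / (1 - \<beta>) * L j) = v + 1 / (1 - \<beta>) * (\<Sum>j\<in>S. p j * max (L j - v) 0)"
proof -
  have "p j * th j * L j = p j * max (L j - v) 0 + v * (p j * th j)" if "j \<in> S" for j
    using th[OF that] by (cases "L j" v rule: linorder_cases) (auto simp: algebra_simps)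
  then have "(\<Sum>j\<in>S. p j * th j * L j) = (\<Sum>j\<in>S. p j * max (L j - v) 0) + v * (1 - \<beta>)"
    unfolding sum[symmetric] sum_distrib_left by (simp add: sum.distrib[symmetric])
  moreover have "(\<Sum>j\<in>S. p j * th j / (1 - \<beta>) * L j) = (\<Sum>j\<in>S. p j * th j * L j) / (1 - \<beta>)"
    by (simp add: sum_divide_distrib)
  ultimately show ?thesis using \<beta> by (simp add: add_divide_distrib)
qed

text \<open>Weak duality for CVaR: shift the losses by \<open>u\<close>, pass to positive parts,
  then replace \<open>q\<close> by its upper bound.\<close>

lemma weighted_loss_le_tail_expectation:
  fixes p L q :: "'j \<Rightarrow> real"
  assumes q: "(\<Sum>j\<in>S. q j) = 1" "\<And>j. j \<in> S \<Longrightarrow> 0 \<le> q j" "\<And>j. j \<in> S \<Longrightarrow> q j \<le> p j / (1 - \<beta>)"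
  shows "(\<Sum>j\<in>S. q j * L j) \<le> u + 1 / (1 - \<beta>) * (\<Sum>j\<in>S. p j * max (L j - u) 0)"
proof -
  have "(\<Sum>j\<in>S. q j * L j) = (\<Sum>j\<in>S. q j * u) + (\<Sum>j\<in>S. q j * (L j - u))"
    by (simp add: sum.distrib[symmetric] algebra_simps)
  also have "(\<Sum>j\<in>S. q j * u) = u" using q(1) by (simp add: sum_distrib_right[symmetric])
  also have "(\<Sum>j\<in>S. q j * (L j - u)) \<le> (\<Sum>j\<in>S. p j / (1 - \<beta>) * max (L j - u) 0)"
  proof (rule sum_mono)
    fix j assume j: "j \<in> S"
    have "q j * (L j - u) \<le> q j * max (L j - u) 0" using q(2)[OF j] by (intro mult_left_mono) auto
    also have "\<dots> \<le> p j / (1 - \<beta>) * max (L j - u) 0" using q(3)[OF j] by (intro mult_right_mono) auto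
    finally show "q j * (L j - u) \<le> p j / (1 - \<beta>) * max (L j - u) 0" .
  qed
  also have "\<dots> = 1 / (1 - \<beta>) * (\<Sum>j\<in>S. p j * max (L j - u) 0)"
    by (simp add: sum_distrib_left)
  finally show ?thesis by simp
qed

text \<open>
  The dual weights that put full mass on the scenarios in \<open>U\<close> and a constant fraction of it on
  those in \<open>V\<close>. With \<open>U\<close> and \<open>V\<close> the scenarios whose loss is above and equal to the quantile
  they are optimal, so finitely many dual vectors suffice for all portfolios. If \<open>V\<close> has no
  mass, then the fraction is \<open>x / 0 = 0\<close>.
\<close>
definition split_fraction :: "('j \<Rightarrow> real) \<Rightarrow> real \<Rightarrow> 'j set \<Rightarrow> 'j set \<Rightarrow> 'j \<Rightarrow> real" where
  "split_fraction p \<beta> U V j =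
    (if j \<in> U then 1 else if j \<in> V then (1 - \<beta> - (\<Sum>i\<in>U. p i)) / (\<Sum>i\<in>V. p i) else 0)"

text \<open>The mass above \<open>v\<close> is at most \<open>1 - \<beta>\<close> and the mass from
  \<open>v\<close> upwards at least \<open>1 - \<beta>\<close>, so a fraction of the ties fills the
  remainder.\<close>

lemma split_fraction_quantile:
  fixes p L :: "'j \<Rightarrow> real"
  assumes S: "finite S" and p: "\<And>j. j \<in> S \<Longrightarrow> 0 \<le> p j" "(\<Sum>j\<in>S. p j) = 1"
    and v: "(\<Sum>j | j \<in> S \<and> L j < v. p j) \<le> \<beta>" "\<beta> \<le> (\<Sum>j | j \<in> S \<and> L j \<le> v. p j)"
  defines "th \<equiv> split_fraction p \<beta> {j \<in> S. L j > v} {j \<in> S. L j = v}"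
  shows "(\<Sum>j\<in>S. p j * th j) = 1 - \<beta>" "\<And>j. 0 \<le> th j \<and> th j \<le> 1"
proof -
  define U where "U = {j \<in> S. L j > v}"
  define V where "V = {j \<in> S. L j = v}"
  define pU where "pU = (\<Sum>j\<in>U. p j)"
  define pV where "pV = (\<Sum>j\<in>V. p j)"
  have fin: "finite U" "finite V" "U \<inter> V = {}" using S by (auto simp: U_def V_def)
  have "(\<Sum>j\<in>S. p j) = (\<Sum>j | j \<in> S \<and> L j \<le> v. p j) + pU"
    unfolding pU_def U_def using S
    by (subst sum.union_disjoint[symmetric]) (auto intro!: sum.cong)
  then have hi: "pU \<le> 1 - \<beta>" using p(2) v(2) by simp
  have "(\<Sum>j\<in>S. p j) = (\<Sum>j | j \<in> S \<and> L j < v. p j) + (\<Sum>j\<in>U \<union> V. p j)"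
    unfolding U_def V_def using S
    by (subst sum.union_disjoint[symmetric]) (auto intro!: sum.cong)
  also have "(\<Sum>j\<in>U \<union> V. p j) = pU + pV"
    unfolding pU_def pV_def using fin by (rule sum.union_disjoint)
  finally have lo: "1 - \<beta> \<le> pU + pV" using p(2) v(1) by simp
  have pV: "0 \<le> pV" unfolding pV_def V_def using p(1) by (intro sum_nonneg) auto
  define c where "c = (1 - \<beta> - pU) / pV"
  have th: "th j = (if j \<in> U then 1 else if j \<in> V then c else 0)" for j
    unfolding th_def split_fraction_def c_def pU_def pV_def U_def V_def by simp
  \<comment> \<open>If \<open>pV = 0\<close>, then \<open>hi\<close> and \<open>lo\<close> force
    \<open>pU = 1 - \<beta>\<close>, and the equation holds with \<open>c = 0\<close>.\<close>
  have c: "0 \<le> c" "c \<le> 1" "c * pV = 1 - \<beta> - pU"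
    using hi lo pV by (auto simp: c_def divide_le_eq_1)
  show "0 \<le> th j \<and> th j \<le> 1" for j using c by (simp add: th)
  have "(\<Sum>j\<in>S. p j * th j) = (\<Sum>j\<in>U \<union> V. p j * th j)"
    using S by (intro sum.mono_neutral_right) (auto simp: U_def V_def th)
  also have "\<dots> = (\<Sum>j\<in>U. p j * th j) + (\<Sum>j\<in>V. p j * th j)"
    using fin by (rule sum.union_disjoint)
  also have "(\<Sum>j\<in>U. p j * th j) = pU" by (simp add: th pU_def)
  also have "(\<Sum>j\<in>V. p j * th j) = (\<Sum>j\<in>V. c * p j)"
    using fin(3) by (intro sum.cong) (auto simp: th)
  also have "\<dots> = c * pV" by (simp add: pV_def sum_distrib_left)
  finally show "(\<Sum>j\<in>S. p j * th j) = 1 - \<beta>" using c by simp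
qed


section \<open>The conditional value at risk as a finite maximum of linear functions\<close>

definition dual_gradient :: "('w, 'n::finite, 't) portfolio \<Rightarrow> 't \<Rightarrow> (nat \<Rightarrow> real) \<Rightarrow> real ^ 'n" where
  "dual_gradient P t q = - (\<Sum>j\<in>scenarios P t. q j *\<^sub>R scen P t j)"

lemma sum_loss_eq: "(\<Sum>j\<in>scenarios P t. q j * loss P t j z) = dual_gradient P t q \<bullet> z"
  by (simp add: dual_gradient_def loss_def inner_sum_left sum_negf)

lemma finite_scenarios [simp]: "finite (scenarios P t)"
  by (simp add: scenarios_def)

definition split_weights :: "('w, 'n::finite, 't) portfolio \<Rightarrow> real \<Rightarrow> 't \<Rightarrow> nat set \<Rightarrow> nat set \<Rightarrow> nat \<Rightarrow> real" where
  "split_weights P \<beta> t U V =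
    restrict (\<lambda>j. wt P t j * split_fraction (wt P t) \<beta> U V j / (1 - \<beta>)) (scenarios P t)"

text \<open>For an arbitrary pair of subsets the split weights may violate the dual constraints; the
  intersection keeps the feasible ones.\<close>

definition dual_candidates :: "('w, 'n::finite, 't) portfolio \<Rightarrow> real \<Rightarrow> 't \<Rightarrow> (nat \<Rightarrow> real) set" where
  "dual_candidates P \<beta> t = Qset P \<beta> t \<inter>
    (\<lambda>(U, V). split_weights P \<beta> t U V) ` (Pow (scenarios P t) \<times> Pow (scenarios P t))"

lemma finite_dual_candidates: "finite (dual_candidates P \<beta> t)"
  unfolding dual_candidates_def by (intro finite_Int disjI2 finite_imageI finite_cartesian_product) auto

lemma dual_gradient_le_cvar_fun:
  assumes "q \<in> Qset P \<beta> t"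
  shows "dual_gradient P t q \<bullet> z \<le> cvar_fun P \<beta> t z u"
  unfolding cvar_fun_def sum_loss_eq[symmetric]
  by (rule weighted_loss_le_tail_expectation) (use assms in \<open>auto simp: Qset_def\<close>)

context portfolio_model
begin

text \<open>The law is given by point masses. Summing over the finitely many scenario values bounds
  every Borel event from below; the same bound for the complement gives the reverse inequality, as
  the weights add up to 1.\<close>

lemma prob_xi:
  assumes "{v. Q v} \<in> sets borel"
  shows "\<P>(\<omega> in sample P. Q (xi P t \<omega>)) = (\<Sum>j | j \<in> scenarios P t \<and> Q (scen P t j). wt P t j)"
proof -
  interpret prob_space "sample P" by (rule prob_space)
  have sets: "{\<omega> \<in> space (sample P). R (xi P t \<omega>)} \<in> events" if "{v. R v} \<in> sets borel" for R
    using measurable_sets[OF random_vector[of t] that]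
    by (simp add: vimage_def Int_def conj_commute)
  define W where "W R = (\<Sum>j | j \<in> scenarios P t \<and> R (scen P t j). wt P t j)" for R
  have ge: "W R \<le> prob {\<omega> \<in> space (sample P). R (xi P t \<omega>)}" if R: "{v. R v} \<in> sets borel" for R
  proof -
    define V where "V = {v \<in> scen P t ` scenarios P t. R v}"
    have "W R = (\<Sum>v\<in>V. \<Sum>j | j \<in> {j \<in> scenarios P t. R (scen P t j)} \<and> scen P t j = v. wt P t j)"
      unfolding W_def by (rule sum.group[symmetric]) (auto simp: V_def)
    also have "\<dots> = (\<Sum>v\<in>V. \<P>(\<omega> in sample P. xi P t \<omega> = v))"
      unfolding law by (intro sum.cong refl) (auto simp: V_def)
    also have "\<dots> = prob (\<Union>v\<in>V. {\<omega> \<in> space (sample P). xi P t \<omega> = v})"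
      by (rule finite_measure_finite_Union[symmetric])
        (auto simp: V_def disjoint_family_on_def intro: sets)
    also have "\<dots> \<le> prob {\<omega> \<in> space (sample P). R (xi P t \<omega>)}"
      by (rule finite_measure_mono) (use sets[OF R] in \<open>auto simp: V_def\<close>)
    finally show ?thesis .
  qed
  have nQ: "{v. \<not> Q v} \<in> sets borel"
    using borel_comp[OF assms] by (simp add: Compl_eq)
  have "W Q + W (\<lambda>v. \<not> Q v) = 1"
    unfolding W_def wt_sum[of t, symmetric]
    by (subst sum.union_disjoint[symmetric]) (auto intro!: sum.cong)
  moreover have "prob {\<omega> \<in> space (sample P). \<not> Q (xi P t \<omega>)}
      = 1 - prob {\<omega> \<in> space (sample P). Q (xi P t \<omega>)}"
    using prob_neg[OF sets[OF assms]] by simp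
  ultimately have "prob {\<omega> \<in> space (sample P). Q (xi P t \<omega>)} \<le> W Q" using ge[OF nQ] by simp
  with ge[OF assms] show ?thesis by (simp add: W_def)
qed

definition quant :: "'t \<Rightarrow> real ^ 'n \<Rightarrow> real" where
  "quant t z = VaR (sample P) (level P) (\<lambda>\<omega>. - (xi P t \<omega> \<bullet> z))"

text \<open>The weight strictly below the quantile is a subset sum less than the level, hence one of
  the sums in \<open>eps_bar\<close>. The choice of \<open>gam\<close> thus leaves a gap of at least
  \<open>gam P\<close> below the level.\<close>

lemma quant_spec:
  shows "level P \<le> (\<Sum>j | j \<in> scenarios P t \<and> loss P t j z \<le> quant t z. wt P t j)"
    and "(\<Sum>j | j \<in> scenarios P t \<and> loss P t j z < quant t z. wt P t j) \<le> level P - gam P"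
proof -
  have "\<P>(\<omega> in sample P. - (xi P t \<omega> \<bullet> z) \<le> u)
      = (\<Sum>j | j \<in> scenarios P t \<and> loss P t j z \<le> u. wt P t j)" for u
    unfolding loss_def by (rule prob_xi) measurable
  then have quant_eq: "quant t z
      = Inf {u. level P \<le> (\<Sum>j | j \<in> scenarios P t \<and> loss P t j z \<le> u. wt P t j)}"
    by (simp add: quant_def VaR_def)
  obtain v where v: "level P \<le> (\<Sum>j | j \<in> scenarios P t \<and> loss P t j z \<le> v. wt P t j)"
      "(\<Sum>j | j \<in> scenarios P t \<and> loss P t j z < v. wt P t j) < level P"
      "\<And>u. level P \<le> (\<Sum>j | j \<in> scenarios P t \<and> loss P t j z \<le> u. wt P t j) \<Longrightarrow> v \<le> u"
    using finite_quantile_exists[OF finite_scenarios[of P t] wt_sum[of t], of "level P" "\<lambda>j. loss P t j z"]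
      level by auto
  have "quant t z = v" unfolding quant_eq by (rule cInf_eq_minimum) (use v in auto)
  then show "level P \<le> (\<Sum>j | j \<in> scenarios P t \<and> loss P t j z \<le> quant t z. wt P t j)"
    using v by simp
  let ?N = "{\<Sum>j\<in>J. wt P t j | J. J \<subseteq> scenarios P t \<and> (\<Sum>j\<in>J. wt P t j) < level P}"
  have "finite ?N"
    by (rule finite_subset[of _ "(\<lambda>J. \<Sum>j\<in>J. wt P t j) ` Pow (scenarios P t)"]) auto
  moreover have "(\<Sum>j | j \<in> scenarios P t \<and> loss P t j z < v. wt P t j) \<in> ?N" using v(2) by blast
  ultimately have "(\<Sum>j | j \<in> scenarios P t \<and> loss P t j z < v. wt P t j) \<le> Max ?N" by (rule Max_ge)
  moreover have "gam P < eps_bar P t" using gam(2) by (simp add: Min_gr_iff)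
  ultimately show "(\<Sum>j | j \<in> scenarios P t \<and> loss P t j z < quant t z. wt P t j) \<le> level P - gam P"
    using \<open>quant t z = v\<close> unfolding eps_bar_def by simp
qed

section \<open>CVaR duality for all levels between \<open>level P - gam P\<close> and
  \<open>level P\<close>\<close>

context
  fixes \<beta> :: real
  assumes \<beta>: "level P - gam P \<le> \<beta>" "\<beta> \<le> level P"
begin

lemma \<beta>_less_1: "\<beta> < 1"
  using \<beta> level by simp

lemma weights_in_Qset:
  assumes "(\<Sum>j\<in>scenarios P t. wt P t j * th j) = 1 - \<beta>"
    and "\<And>j. j \<in> scenarios P t \<Longrightarrow> 0 \<le> th j \<and> th j \<le> 1"
  shows "restrict (\<lambda>j. wt P t j * th j / (1 - \<beta>)) (scenarios P t) \<in> Qset P \<beta> t"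
proof -
  have "wt P t j * th j \<le> wt P t j" if "j \<in> scenarios P t" for j
    using mult_left_mono[of "th j" 1 "wt P t j"] wt_pos[OF that] assms(2)[OF that] by simp
  then show ?thesis
    using assms wt_pos \<beta>_less_1
    by (auto simp: Qset_def sum_divide_distrib[symmetric] divide_right_mono less_imp_le)
qed

text \<open>By \<open>quant_spec\<close> the same value is a quantile for every level in this range,
  so splitting the scenarios there gives feasible dual weights.\<close>

lemma split_weights_optimal:
  "\<exists>q\<in>dual_candidates P \<beta> t. dual_gradient P t q \<bullet> z = cvar_fun P \<beta> t z (quant t z)"
proof -
  define L where "L j = loss P t j z" for j
  define U where "U = {j \<in> scenarios P t. L j > quant t z}"
  define V where "V = {j \<in> scenarios P t. L j = quant t z}"
  define th where "th = split_fraction (wt P t) \<beta> U V"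
  have "(\<Sum>j | j \<in> scenarios P t \<and> L j < quant t z. wt P t j) \<le> \<beta>"
    "\<beta> \<le> (\<Sum>j | j \<in> scenarios P t \<and> L j \<le> quant t z. wt P t j)"
    using quant_spec[of t z] \<beta> by (simp_all add: L_def)
  from split_fraction_quantile[OF finite_scenarios less_imp_le[OF wt_pos] wt_sum this]
  have th: "(\<Sum>j\<in>scenarios P t. wt P t j * th j) = 1 - \<beta>" "\<And>j. 0 \<le> th j \<and> th j \<le> 1"
    by (simp_all add: th_def U_def V_def)
  let ?q = "split_weights P \<beta> t U V"
  have "?q \<in> Qset P \<beta> t"
    using weights_in_Qset[OF th] by (simp add: split_weights_def th_def)
  moreover have "U \<subseteq> scenarios P t" "V \<subseteq> scenarios P t" by (auto simp: U_def V_def)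
  ultimately have "?q \<in> dual_candidates P \<beta> t" unfolding dual_candidates_def by auto
  moreover have "dual_gradient P t ?q \<bullet> z = (\<Sum>j\<in>scenarios P t. wt P t j * th j / (1 - \<beta>) * L j)"
    unfolding sum_loss_eq[symmetric] by (simp add: split_weights_def th_def L_def)
  moreover have "\<dots> = cvar_fun P \<beta> t z (quant t z)"
    unfolding cvar_fun_def L_def[symmetric]
    by (rule tail_expectation_eq[OF finite_scenarios \<beta>_less_1 _ _ th(1)])
      (auto simp: th_def split_fraction_def U_def V_def)
  ultimately show ?thesis by metis
qed

text \<open>The dual value from \<open>split_weights_optimal\<close> bounds all values of the CVaR
  function from below and is attained at the quantile. The minimizer does not depend on
  \<open>\<beta>\<close>.\<close>

lemma psi_eq_cvar_fun_quant: "psi P \<beta> t z = cvar_fun P \<beta> t z (quant t z)"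
  unfolding psi_def
proof (rule cInf_eq_minimum)
  fix r assume "r \<in> range (cvar_fun P \<beta> t z)"
  then obtain u where "r = cvar_fun P \<beta> t z u" by blast
  then show "cvar_fun P \<beta> t z (quant t z) \<le> r"
    using split_weights_optimal[of t z] dual_gradient_le_cvar_fun unfolding dual_candidates_def
    by (metis IntD1)
qed simp

lemma psi_eq_dual: "\<exists>q\<in>dual_candidates P \<beta> t. psi P \<beta> t z = dual_gradient P t q \<bullet> z"
  using split_weights_optimal[of t z] psi_eq_cvar_fun_quant[of t z] by metis

lemma dual_gradient_le_psi: "q \<in> Qset P \<beta> t \<Longrightarrow> dual_gradient P t q \<bullet> z \<le> psi P \<beta> t z"
  unfolding psi_eq_cvar_fun_quant by (rule dual_gradient_le_cvar_fun)

lemma dual_gradient_subgradient: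
  assumes "q \<in> Qset P \<beta> t" "dual_gradient P t q \<bullet> z = psi P \<beta> t z"
  shows "dual_gradient P t q \<in> subdifferential (psi P \<beta> t) z"
  using assms dual_gradient_le_psi by (simp add: subdifferential_def inner_diff_right)

lemma convex_psi: "convex_on UNIV (psi P \<beta> t)"
proof (rule convex_onI)
  fix s :: real and x y :: "real ^ 'n"
  assume s: "0 < s" "s < 1"
  obtain q where "q \<in> dual_candidates P \<beta> t"
      and eq: "psi P \<beta> t ((1 - s) *\<^sub>R x + s *\<^sub>R y) = dual_gradient P t q \<bullet> ((1 - s) *\<^sub>R x + s *\<^sub>R y)"
    using psi_eq_dual by blast
  then have q: "q \<in> Qset P \<beta> t" by (simp add: dual_candidates_def)
  show "psi P \<beta> t ((1 - s) *\<^sub>R x + s *\<^sub>R y) \<le> (1 - s) * psi P \<beta> t x + s * psi P \<beta> t y"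
    unfolding eq inner_add_right inner_scaleR_right
    using s dual_gradient_le_psi[OF q] by (intro add_mono mult_left_mono) auto
qed simp

text \<open>Uniqueness makes every other dual candidate strictly worse at \<open>z0\<close>. There
  are finitely many, so by continuity all of them stay worse on a common ball.\<close>

lemma psi_locally_linear:
  assumes sing: "is_singleton (Mset P \<beta> t z0)"
  shows "\<exists>g r. r > 0 \<and> (\<forall>z\<in>ball z0 r. psi P \<beta> t z = g \<bullet> z)"
proof -
  have M: "q \<in> Mset P \<beta> t z0" if "q \<in> Qset P \<beta> t" "dual_gradient P t q \<bullet> z0 = psi P \<beta> t z0" for q
  proof -
    have "- (\<Sum>j\<in>scenarios P t. q j * (scen P t j \<bullet> z0)) = dual_gradient P t q \<bullet> z0" for q
      by (simp add: dual_gradient_def inner_sum_left)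
    then show ?thesis
      using that dual_gradient_le_psi by (auto simp: Mset_def is_arg_max_def not_less)
  qed
  obtain q0 where q0: "q0 \<in> dual_candidates P \<beta> t" "psi P \<beta> t z0 = dual_gradient P t q0 \<bullet> z0"
    using psi_eq_dual by blast
  have less: "dual_gradient P t q \<bullet> z0 < dual_gradient P t q0 \<bullet> z0"
    if "q \<in> dual_candidates P \<beta> t - {q0}" for q
  proof -
    have "q \<in> Qset P \<beta> t" "q0 \<in> Qset P \<beta> t" using that q0 by (auto simp: dual_candidates_def)
    moreover have "q \<notin> Mset P \<beta> t z0"
      using that M[OF \<open>q0 \<in> Qset P \<beta> t\<close>] q0 sing by (metis DiffE is_singletonE singletonD singletonI)
    ultimately show ?thesis using M dual_gradient_le_psi[of q] q0(2) by (metis order_le_less)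
  qed
  let ?O = "\<Inter>q\<in>dual_candidates P \<beta> t - {q0}. {z. dual_gradient P t q \<bullet> z < dual_gradient P t q0 \<bullet> z}"
  have O: "open ?O"
    by (intro open_INT ballI open_Collect_less continuous_intros) (simp add: finite_dual_candidates)
  have z0: "z0 \<in> ?O" using less by blast
  obtain r where r: "r > 0" "ball z0 r \<subseteq> ?O" using openE[OF O z0] .
  have "psi P \<beta> t z = dual_gradient P t q0 \<bullet> z" if z: "z \<in> ball z0 r" for z
  proof -
    obtain q where q: "q \<in> dual_candidates P \<beta> t" "psi P \<beta> t z = dual_gradient P t q \<bullet> z"
      using psi_eq_dual by blast
    have "dual_gradient P t q0 \<bullet> z \<le> psi P \<beta> t z"
      using q0 dual_gradient_le_psi by (simp add: dual_candidates_def)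
    moreover have "dual_gradient P t q \<bullet> z < dual_gradient P t q0 \<bullet> z" if "q \<noteq> q0"
      using subsetD[OF r(2) z] q(1) that by simp
    ultimately have "q = q0" using q(2) by (metis not_less)
    then show ?thesis using q by simp
  qed
  then show ?thesis using r by blast
qed

end

text \<open>Both CVaRs are evaluated at their common minimizer, the quantile. The factors
  \<open>Agam\<close> and \<open>Bgam\<close> scale both excess terms to \<open>E / gam P\<close>,
  which cancels, and \<open>Agam P - Bgam P = 1\<close>.\<close>

lemma VaR_eq_psi:
  "VaR (sample P) (level P) (\<lambda>\<omega>. - (xi P t \<omega> \<bullet> z))
    = Agam P * psi P (level P - gam P) t z - Bgam P * psi P (level P) t z"
proof -
  define E where "E = (\<Sum>j\<in>scenarios P t. wt P t j * max (loss P t j z - quant t z) 0)"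
  have psi: "psi P (level P - gam P) t z = quant t z + E / (1 - level P + gam P)"
    "psi P (level P) t z = quant t z + E / (1 - level P)"
    using gam(1) psi_eq_cvar_fun_quant[of "level P - gam P" t z] psi_eq_cvar_fun_quant[of "level P" t z]
    by (simp_all add: cvar_fun_def E_def algebra_simps)
  have nz: "1 - level P + gam P \<noteq> 0" "1 - level P \<noteq> 0" "gam P \<noteq> 0" using level gam(1) by auto
  have cancel: "k / c * (v + E / k) = k / c * v + E / c" if "k \<noteq> 0" for k c v :: real
    using that by (simp add: distrib_left)
  have "Agam P * psi P (level P - gam P) t z = Agam P * quant t z + E / gam P"
    unfolding psi Agam_def by (rule cancel) (rule nz)
  moreover have "Bgam P * psi P (level P) t z = Bgam P * quant t z + E / gam P"
    unfolding psi Bgam_def by (rule cancel) (rule nz)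
  moreover have "Agam P - Bgam P = 1"
    using nz by (simp add: Agam_def Bgam_def diff_divide_distrib[symmetric])
  ultimately show ?thesis
    unfolding quant_def[symmetric] by (metis add_diff_cancel_right left_diff_distrib mult_1)
qed

lemma Phi_eq_DC: "Phi P \<rho> x = Gfun P \<rho> x - Hfun P \<rho> x"
proof -
  have "max (a - b - c) 0 = max (a - c) b - b" for a b c :: real by (simp add: max_def)
  then show ?thesis
    unfolding Phi_def Gfun_def Hfun_def risk_def VaR_eq_psi
    by (simp add: sum_subtractf sum_distrib_left[symmetric] right_diff_distrib)
qed

text \<open>The tie-breaking weights define a feasible dual vector, which is optimal because
  \<open>tail_expectation_eq\<close> evaluates it at a minimizer \<open>u\<close>.\<close>

lemma cvar_subgrads_subset:
  assumes g: "g \<in> cvar_subgrads P t z"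
  shows "g \<in> subdifferential (psi P (level P) t) z"
proof -
  have b: "level P - gam P \<le> level P" "level P \<le> level P" using gam(1) by auto
  obtain u th where u: "is_arg_min (cvar_fun P (level P) t z) (\<lambda>_. True) u"
    and th: "\<And>j. j \<in> scenarios P t \<Longrightarrow> loss P t j z > u \<Longrightarrow> th j = 1"
      "\<And>j. j \<in> scenarios P t \<Longrightarrow> loss P t j z = u \<Longrightarrow> 0 \<le> th j \<and> th j \<le> 1"
      "\<And>j. j \<in> scenarios P t \<Longrightarrow> loss P t j z < u \<Longrightarrow> th j = 0"
    and sum: "(\<Sum>j\<in>scenarios P t. wt P t j * th j) = 1 - level P"
    and g_eq: "g = - (1 / (1 - level P)) *\<^sub>R (\<Sum>j\<in>scenarios P t. (wt P t j * th j) *\<^sub>R scen P t j)"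
    using g unfolding cvar_subgrads_def by blast
  define q where "q = restrict (\<lambda>j. wt P t j * th j / (1 - level P)) (scenarios P t)"
  have "0 \<le> th j \<and> th j \<le> 1" if "j \<in> scenarios P t" for j
    using th[OF that] by (cases "loss P t j z" u rule: linorder_cases) auto
  then have q: "q \<in> Qset P (level P) t" unfolding q_def by (intro weights_in_Qset[OF b sum])
  have "dual_gradient P t q = g"
    unfolding g_eq dual_gradient_def q_def by (simp add: scaleR_sum_right sum_negf)
  moreover have "dual_gradient P t q \<bullet> z = psi P (level P) t z"
  proof -
    have "dual_gradient P t q \<bullet> z = (\<Sum>j\<in>scenarios P t. wt P t j * th j / (1 - level P) * loss P t j z)"
      unfolding sum_loss_eq[symmetric] by (simp add: q_def)
    also have "\<dots> = cvar_fun P (level P) t z u"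
      unfolding cvar_fun_def by (rule tail_expectation_eq[OF finite_scenarios level(2) th(1,3) sum])
    also have "\<dots> = psi P (level P) t z"
      unfolding psi_def by (rule cInf_eq_minimum[symmetric]) (use u in \<open>auto simp: is_arg_min_def not_less\<close>)
    finally show ?thesis .
  qed
  ultimately show ?thesis using dual_gradient_subgradient[OF b q] by simp
qed

end


section \<open>Convexity of the model functions\<close>

lemma convex_on_sum_fun:
  assumes "finite I" "convex S" "\<And>i. i \<in> I \<Longrightarrow> convex_on S (f i)"
  shows "convex_on S (\<lambda>x. \<Sum>i\<in>I. f i x)"
  using assms(1,3)
proof (induction I rule: finite_induct)
  case empty
  then show ?case using assms(2) by (simp add: convex_on_const)
next
  case (insert i I)
  then show ?case by (simp add: convex_on_add)
qed

lemma convex_on_compose_linear: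
  assumes "linear l" "convex_on UNIV f"
  shows "convex_on UNIV (\<lambda>x. f (l x))"
  using assms unfolding convex_on_def by (simp add: linear_add linear_scale)

lemma convex_on_max:
  fixes f g :: "'a::real_vector \<Rightarrow> real"
  assumes "convex_on S f" "convex_on S g"
  shows "convex_on S (\<lambda>x. max (f x) (g x))"
proof (rule convex_onI)
  show "convex S" using assms(1) by (rule convex_on_imp_convex)
  fix t :: real and x y assume t: "0 < t" "t < 1" and xy: "x \<in> S" "y \<in> S"
  have "f ((1 - t) *\<^sub>R x + t *\<^sub>R y) \<le> (1 - t) * f x + t * f y"
    "g ((1 - t) *\<^sub>R x + t *\<^sub>R y) \<le> (1 - t) * g x + t * g y"
    using convex_onD[OF assms(1)] convex_onD[OF assms(2)] t xy by simp_all
  moreover have "(1 - t) * f x \<le> (1 - t) * max (f x) (g x)" "t * f y \<le> t * max (f y) (g y)"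
    "(1 - t) * g x \<le> (1 - t) * max (f x) (g x)" "t * g y \<le> t * max (f y) (g y)"
    using t by (simp_all add: mult_left_mono)
  ultimately show "max (f ((1 - t) *\<^sub>R x + t *\<^sub>R y)) (g ((1 - t) *\<^sub>R x + t *\<^sub>R y))
      \<le> (1 - t) * max (f x) (g x) + t * max (f y) (g y)"
    by simp
qed

lemma convex_on_abs_diff_const:
  fixes b :: real
  shows "convex_on UNIV (\<lambda>r::real. \<bar>r - b\<bar>)"
  using convex_on_dist[of UNIV b] by (simp add: dist_real_def abs_minus_commute)

lemma convex_on_linear_fun:
  fixes l :: "'a::real_vector \<Rightarrow> real"
  assumes "linear l"
  shows "convex_on UNIV l"
  using assms by (simp add: convex_on_def linear_add linear_scale)

lemma norm_plan_sq: "(norm (x :: ('n::finite, 't::finite) plan))\<^sup>2 = (\<Sum>t\<in>UNIV. (norm (x $ t))\<^sup>2)"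
  unfolding norm_vec_def L2_set_def by (subst real_sqrt_pow2) (auto intro: sum_nonneg)

text \<open>Plays the role of \<open>Gc\<close>: removing the quadratic term of \<open>obj\<close>
  leaves a convex function.\<close>

definition Gbase :: "('w, 'n::finite, 't::{finite,linorder}) portfolio \<Rightarrow> real \<Rightarrow> ('n, 't) plan \<Rightarrow> real"
  where "Gbase P \<rho> x = Gfun P \<rho> x - lam2 P * (norm x)\<^sup>2"

context portfolio_model
begin

lemma Gfun_eq: "Gfun P \<rho> x = Gbase P \<rho> x + lam2 P * (norm x)\<^sup>2"
  by (simp add: Gbase_def)

lemma convex_psi_stage:
  assumes "\<beta> = level P - gam P \<or> \<beta> = level P"
  shows "convex_on UNIV (\<lambda>x :: ('n, 't) plan. psi P \<beta> t (x $ t))"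
  by (rule convex_on_compose_linear[OF _ convex_psi])
    (use assms gam(1) in \<open>auto intro: linearI\<close>)

lemma Bgam_pos: "Bgam P > 0"
  using level gam(1) by (simp add: Bgam_def)

lemma convex_Gbase:
  assumes "\<rho> > 0"
  shows "convex_on UNIV (Gbase P \<rho>)"
proof -
  \<comment> \<open>\<open>Gbase\<close> rewritten with \<open>- 0\<close> and
    \<open>+ (- tau P)\<close> so that the convexity rules for absolute differences and sums
    match.\<close>
  define K where "K = (\<lambda>x :: ('n, 't) plan.
      (- (\<Sum>t\<in>UNIV. mu P t \<bullet> x $ t)
      + lam1 P * ((\<Sum>i\<in>UNIV. cost P i * \<bar>x $ first_stage $ i - wprev P $ i\<bar>)
        + (\<Sum>t\<in>UNIV - {first_stage}. \<Sum>i\<in>UNIV. cost P i * \<bar>(x $ t $ i - x $ prev_stage t $ i) - 0\<bar>)))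
      + \<rho> * (\<Sum>t\<in>UNIV. max (Agam P * psi P (level P - gam P) t (x $ t) + (- tau P))
          (Bgam P * psi P (level P) t (x $ t))))"
  have AB: "Agam P \<ge> 0" "Bgam P \<ge> 0" using level gam(1) by (auto simp: Agam_def Bgam_def)
  have "convex_on UNIV (\<lambda>x :: ('n, 't) plan. - (\<Sum>t\<in>UNIV. mu P t \<bullet> x $ t))"
    by (rule convex_on_linear_fun, rule linearI)
      (simp_all add: inner_add_right sum.distrib sum_distrib_left)
  moreover have "convex_on UNIV (\<lambda>x :: ('n, 't) plan. \<Sum>i\<in>UNIV. cost P i * \<bar>x $ first_stage $ i - wprev P $ i\<bar>)"
    by (intro convex_on_sum_fun convex_on_cmul cost_nonneg
        convex_on_compose_linear[OF _ convex_on_abs_diff_const]) (auto intro: linearI)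
  moreover have "convex_on UNIV (\<lambda>x :: ('n, 't) plan. \<Sum>t\<in>UNIV - {first_stage}. \<Sum>i\<in>UNIV.
      cost P i * \<bar>(x $ t $ i - x $ prev_stage t $ i) - 0\<bar>)"
    by (intro convex_on_sum_fun convex_on_cmul cost_nonneg
        convex_on_compose_linear[OF _ convex_on_abs_diff_const])
      (auto intro!: linearI simp: algebra_simps)
  moreover have "convex_on UNIV (\<lambda>x :: ('n, 't) plan. \<Sum>t\<in>UNIV.
      max (Agam P * psi P (level P - gam P) t (x $ t) + (- tau P)) (Bgam P * psi P (level P) t (x $ t)))"
    by (intro convex_on_sum_fun convex_on_max convex_on_add convex_on_cmul convex_psi_stage AB)
      (auto simp: convex_on_const)
  ultimately have K: "convex_on UNIV K"
    unfolding K_def using lam1_pos assms by (intro convex_on_add convex_on_cmul) auto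
  have "Gbase P \<rho> x = K x" for x
    unfolding Gbase_def Gfun_def obj_def norm_plan_sq K_def by simp
  then have "Gbase P \<rho> = K" by (rule ext)
  then show ?thesis using K by simp
qed

lemma convex_Gfun:
  assumes "\<rho> > 0"
  shows "convex_on UNIV (Gfun P \<rho>)"
  using convex_on_add[OF convex_Gbase[OF assms] convex_on_cmul[OF less_imp_le[OF lam2_pos] convex_on_norm_sq]]
  by (simp add: Gfun_eq[abs_def])

lemma convex_Hfun:
  assumes "\<rho> > 0"
  shows "convex_on UNIV (Hfun P \<rho>)"
  unfolding Hfun_def[abs_def]
  using assms Bgam_pos by (intro convex_on_cmul convex_on_sum_fun convex_psi_stage) auto

lemma Hfun_subgradient:
  assumes "\<rho> > 0" and g: "\<And>t. g $ t \<in> cvar_subgrads P t (w $ t)"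
  shows "(\<rho> * Bgam P) *\<^sub>R g \<in> subdifferential (Hfun P \<rho>) w"
proof -
  have "Hfun P \<rho> w + ((\<rho> * Bgam P) *\<^sub>R g) \<bullet> (z - w) \<le> Hfun P \<rho> z" for z
  proof -
    have "psi P (level P) t (w $ t) + g $ t \<bullet> (z $ t - w $ t) \<le> psi P (level P) t (z $ t)" for t
      using cvar_subgrads_subset[OF g[of t]] by (simp add: subdifferential_def)
    then have "(\<Sum>t\<in>UNIV. psi P (level P) t (w $ t) + g $ t \<bullet> (z $ t - w $ t))
        \<le> (\<Sum>t\<in>UNIV. psi P (level P) t (z $ t))" by (intro sum_mono)
    then have "(\<Sum>t\<in>UNIV. psi P (level P) t (w $ t)) + g \<bullet> (z - w)
        \<le> (\<Sum>t\<in>UNIV. psi P (level P) t (z $ t))"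
      by (simp add: sum.distrib inner_vec_def)
    then have "(\<rho> * Bgam P) * ((\<Sum>t\<in>UNIV. psi P (level P) t (w $ t)) + g \<bullet> (z - w))
        \<le> (\<rho> * Bgam P) * (\<Sum>t\<in>UNIV. psi P (level P) t (z $ t))"
      using assms(1) Bgam_pos by (intro mult_left_mono) auto
    then show ?thesis by (simp add: Hfun_def distrib_left)
  qed
  then show ?thesis by (simp add: subdifferential_def)
qed

text \<open>The stages decouple: a block of a plan moves no farther than the plan, so the smallest
  of the stage radii works for all stages.\<close>

lemma Hfun_locally_affine:
  fixes a :: "('n, 't) plan"
  assumes "\<And>t. is_singleton (Mset P (level P) t (a $ t))"
  shows "\<exists>h r. r > 0 \<and> (\<forall>z\<in>ball a r. Hfun P \<rho> z = Hfun P \<rho> a + h \<bullet> (z - a))"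
proof -
  have "\<forall>t. \<exists>g r. r > 0 \<and> (\<forall>z\<in>ball (a $ t) r. psi P (level P) t z = g \<bullet> z)"
    using psi_locally_linear[OF _ _ assms] gam(1) by simp
  then obtain g r where gr: "\<And>t. r t > 0" "\<And>t z. z \<in> ball (a $ t) (r t) \<Longrightarrow> psi P (level P) t z = g t \<bullet> z"
    by metis
  define R where "R = (MIN t. r t)"
  have R: "R > 0" "\<And>t. R \<le> r t" using gr(1) by (simp_all add: R_def Min_gr_iff)
  have H: "Hfun P \<rho> z = ((\<rho> * Bgam P) *\<^sub>R (\<chi> t. g t)) \<bullet> z" if "z \<in> ball a R" for z
  proof -
    have "z $ t \<in> ball (a $ t) (r t)" for t
      using le_less_trans[OF dist_vec_nth_le[of a t z]] that less_le_trans[OF _ R(2)] by (metis mem_ball)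
    then have "psi P (level P) t (z $ t) = g t \<bullet> z $ t" for t using gr(2) by blast
    moreover have "(\<chi> t. g t) \<bullet> z = (\<Sum>t\<in>UNIV. g t \<bullet> z $ t)" by (subst inner_vec_def) simp
    ultimately show ?thesis by (simp add: Hfun_def)
  qed
  have "Hfun P \<rho> z = Hfun P \<rho> a + ((\<rho> * Bgam P) *\<^sub>R (\<chi> t. g t)) \<bullet> (z - a)" if "z \<in> ball a R" for z
    using H[OF that] H[of a] R(1) by (simp add: inner_diff_right right_diff_distrib)
  then show ?thesis using R(1) by blast
qed

end


section \<open>The steps of the algorithm\<close>

lemma convex_feasible: "convex (feasible :: ('n::finite, 't::finite) plan set)"
proof (rule convexI)
  fix x y :: "('n, 't) plan" and a b :: real
  assume "x \<in> feasible" "y \<in> feasible" "0 \<le> a" "0 \<le> b" "a + b = 1"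
  then show "a *\<^sub>R x + b *\<^sub>R y \<in> feasible"
    by (auto simp: feasible_def simplex1_def sum.distrib sum_distrib_left[symmetric])
qed

lemma closed_feasible: "closed (feasible :: ('n::finite, 't::finite) plan set)"
proof -
  have "feasible = (\<Inter>t. {x :: ('n, 't) plan. (\<Sum>i\<in>UNIV. x $ t $ i) = 1} \<inter> (\<Inter>i. {x. 0 \<le> x $ t $ i}))"
    by (auto simp: feasible_def simplex1_def)
  moreover have "closed \<dots>"
    by (intro closed_INT ballI closed_Int closed_Collect_eq closed_Collect_le continuous_intros)
  ultimately show ?thesis by simp
qed

lemma bounded_feasible: "bounded (feasible :: ('n::finite, 't::finite) plan set)"
proof -
  have "norm x \<le> real CARD('t) * real CARD('n)" if x: "x \<in> feasible" for x :: "('n, 't) plan"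
  proof -
    have "norm (x $ t) \<le> real CARD('n)" for t
    proof -
      have "norm (x $ t) \<le> (\<Sum>i\<in>UNIV. \<bar>x $ t $ i\<bar>)" by (rule norm_le_l1_cart)
      also have "\<dots> = 1" using x by (simp add: feasible_def simplex1_def)
      also have "\<dots> \<le> real CARD('n)" by (simp add: Suc_leI)
      finally show ?thesis .
    qed
    then have "(\<Sum>t\<in>UNIV. norm (x $ t)) \<le> real CARD('t) * real CARD('n)"
      using sum_bounded_above[of "UNIV :: 't set" "\<lambda>t. norm (x $ t)"] by simp
    moreover have "norm x \<le> (\<Sum>t\<in>UNIV. norm (x $ t))"
      unfolding norm_vec_def by (rule L2_set_le_sum) simp
    ultimately show ?thesis by simp
  qed
  then show ?thesis unfolding bounded_iff by blast
qed

text \<open>The admissible step lengths form a compact set containing 1, by boundedness of the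
  feasible set and \<open>y \<noteq> w\<close>; so \<open>GREATEST\<close> denotes an attained
  maximum.\<close>

lemma max_step_spec:
  fixes w y :: "('n::finite, 't::finite) plan"
  assumes y: "y \<in> feasible" and d: "y \<noteq> w"
  shows "1 \<le> max_step w (y - w) \<and> w + max_step w (y - w) *\<^sub>R (y - w) \<in> feasible"
proof -
  define T where "T = {l. 1 \<le> l \<and> w + l *\<^sub>R (y - w) \<in> feasible}"
  have "T = {1..} \<inter> (\<lambda>l. w + l *\<^sub>R (y - w)) -` feasible" by (auto simp: T_def)
  moreover have "closed \<dots>"
    by (intro closed_Int closed_vimage closed_feasible continuous_intros)
  moreover have "bounded T"
  proof -
    obtain M where M: "\<And>x :: ('n, 't) plan. x \<in> feasible \<Longrightarrow> norm x \<le> M"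
      using bounded_feasible unfolding bounded_iff by blast
    have "norm l \<le> (M + norm w) / norm (y - w)" if "l \<in> T" for l
    proof -
      have "norm (l *\<^sub>R (y - w)) \<le> norm (w + l *\<^sub>R (y - w)) + norm w"
        using norm_triangle_ineq4[of "w + l *\<^sub>R (y - w)" w] by simp
      also have "\<dots> \<le> M + norm w" using M that by (simp add: T_def)
      finally have "\<bar>l\<bar> * norm (y - w) \<le> M + norm w" by (simp only: norm_scaleR)
      then show ?thesis using d by (simp add: pos_le_divide_eq)
    qed
    then show ?thesis unfolding bounded_iff by blast
  qed
  ultimately have "compact T" by (simp add: compact_eq_bounded_closed)
  moreover have "1 \<in> T" using y by (simp add: T_def)
  ultimately obtain l where l: "l \<in> T" "\<And>l'. l' \<in> T \<Longrightarrow> l' \<le> l"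
    using compact_attains_sup[of T] by blast
  have "max_step w (y - w) = l"
    unfolding max_step_def by (rule Greatest_equality) (use l in \<open>auto simp: T_def\<close>)
  then show ?thesis using l(1) by (simp add: T_def)
qed

text \<open>Termination measure: the number of reductions by the factor \<open>\<eta>\<close> that lead from \<open>l\<close> to \<open>1\<close>.\<close>
lemma wf_backtracking:
  fixes \<eta> :: real
  assumes "0 < \<eta>" "\<eta> < 1"
  shows "wf {(max 1 (\<eta> * l), l) | l. l > 1}"
proof (rule wf_subset[OF wf_measure])
  define m where "m l = nat \<lceil>ln l / - ln \<eta>\<rceil>" for l
  have n: "- ln \<eta> > 0" using assms by simp
  have "m (max 1 (\<eta> * l)) < m l" if l: "l > 1" for l
  proof -
    have pos: "ln l / - ln \<eta> > 0" using l n by (intro divide_pos_pos) auto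
    show ?thesis
    proof (cases "\<eta> * l \<le> 1")
      case True
      then show ?thesis using pos by (simp add: m_def max_def)
    next
      case False
      have "ln (\<eta> * l) / - ln \<eta> = ln l / - ln \<eta> - 1"
        using l assms n by (simp add: ln_mult field_simps)
      then have "m (\<eta> * l) = nat (\<lceil>ln l / - ln \<eta>\<rceil> - 1)" by (simp add: m_def)
      moreover have "max 1 (\<eta> * l) = \<eta> * l" using False by simp
      moreover have "\<lceil>ln l / - ln \<eta>\<rceil> > 0" using pos by (simp only: zero_less_ceiling)
      ultimately show ?thesis by (simp add: m_def)
    qed
  qed
  then show "{(max 1 (\<eta> * l), l) | l. l > 1} \<subseteq> Wellfounded.measure m" by auto
qed

text \<open>The loop exits either with the test failed, which is both inequalities, or at length 1,
  where \<open>dec\<close> supplies them.\<close>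

lemma line_search_spec:
  fixes w y :: "('n::finite, 't::{finite,linorder}) plan"
  assumes A: "valid_params P A" and w: "w \<in> feasible" and y: "y \<in> feasible" and d: "y \<noteq> w"
    and dec: "Phi P (rho A) y \<le> Phi P (rho A) w - sigma A * (norm (y - w))\<^sup>2"
  defines "l \<equiv> line_search P A w y"
  shows "1 \<le> l" "w + l *\<^sub>R (y - w) \<in> feasible"
    "Phi P (rho A) (w + l *\<^sub>R (y - w)) \<le> Phi P (rho A) y"
    "Phi P (rho A) (w + l *\<^sub>R (y - w)) \<le> Phi P (rho A) w - sigma A * (norm (l *\<^sub>R (y - w)))\<^sup>2"
proof -
  let ?m = "max_step w (y - w)"
  let ?c = "\<lambda>l. Phi P (rho A) (w + l *\<^sub>R (y - w))
    > min (Phi P (rho A) y) (Phi P (rho A) w - sigma A * l\<^sup>2 * (norm (y - w))\<^sup>2)"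
  have pars: "0 < eta A" "eta A < 1" "1 < lambar A" using A by (auto simp: valid_params_def)
  have m: "1 \<le> ?m" "w + ?m *\<^sub>R (y - w) \<in> feasible" using max_step_spec[OF y d] by auto
  have "(1 \<le> l \<and> l \<le> ?m) \<and> \<not> (l > 1 \<and> ?c l)"
    unfolding l_def line_search_def Let_def
  proof (rule while_rule[where P = "\<lambda>l. 1 \<le> l \<and> l \<le> ?m", OF _ _ _ wf_backtracking[OF pars(1,2)]])
    show "1 \<le> min (lambar A) ?m \<and> min (lambar A) ?m \<le> ?m" using m pars by simp
  next
    fix s :: real
    assume s: "1 \<le> s \<and> s \<le> ?m" "1 < s \<and> ?c s"
    have "eta A * s \<le> s" using s(1) pars by (simp add: mult_left_le_one_le)
    then have "eta A * s \<le> ?m" using s(1) by linarith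
    then show "1 \<le> max 1 (eta A * s) \<and> max 1 (eta A * s) \<le> ?m" using m(1) by simp
    show "(max 1 (eta A * s), s) \<in> {(max 1 (eta A * l), l) | l. l > 1}" using s by blast
  qed auto
  then have l: "1 \<le> l" "l \<le> ?m" "\<not> (l > 1 \<and> ?c l)" by auto
  then show "1 \<le> l" by simp
  \<comment> \<open>The trial point lies on the segment from \<open>w\<close> to the farthest
    feasible point.\<close>
  have "w + (l / ?m) *\<^sub>R ((w + ?m *\<^sub>R (y - w)) - w) \<in> feasible"
    by (rule chord_in_convex[OF convex_feasible w m(2)]) (use l m in auto)
  then show "w + l *\<^sub>R (y - w) \<in> feasible" using m(1) by simp
  show "Phi P (rho A) (w + l *\<^sub>R (y - w)) \<le> Phi P (rho A) y"
    "Phi P (rho A) (w + l *\<^sub>R (y - w)) \<le> Phi P (rho A) w - sigma A * (norm (l *\<^sub>R (y - w)))\<^sup>2"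
    using l dec by (cases "l = 1"; auto simp: power_mult_distrib min_def not_less mult.assoc split: if_splits)+
qed

text \<open>Projection is nonexpansive and fixes \<open>x\<close>; after a reset the displacement is
  zero.\<close>

lemma extrapolate_spec:
  fixes x xp :: "('n::finite, 't::{finite,linorder}) plan"
  assumes x: "x \<in> feasible" and \<theta>: "0 \<le> theta A"
  shows "extrapolate P A xp x \<in> feasible"
    and "norm (extrapolate P A xp x - x) \<le> theta A * norm (x - xp)"
    and "Phi P (rho A) (extrapolate P A xp x) \<le> Phi P (rho A) x"
proof -
  have ne: "feasible \<noteq> ({} :: ('n, 't) plan set)" using x by blast
  let ?p = "closest_point feasible (x + theta A *\<^sub>R (x - xp))"
  have "dist ?p (closest_point feasible x) \<le> dist (x + theta A *\<^sub>R (x - xp)) x"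
    using closest_point_lipschitz[OF convex_feasible closed_feasible ne] .
  then have "norm (?p - x) \<le> theta A * norm (x - xp)"
    using \<theta> by (simp add: closest_point_self[OF x] dist_norm)
  moreover have "?p \<in> feasible" using closest_point_in_set[OF closed_feasible ne] .
  ultimately show "extrapolate P A xp x \<in> feasible"
    and "norm (extrapolate P A xp x - x) \<le> theta A * norm (x - xp)"
    and "Phi P (rho A) (extrapolate P A xp x) \<le> Phi P (rho A) x"
    using x \<theta> by (auto simp: extrapolate_def Let_def)
qed

lemma ibdca_iteration_subproblem:
  fixes w y :: "('n::finite, 't::{finite,linorder}) plan"
  assumes P: "portfolio_model P" and A: "valid_params P A" and it: "ibdca_iteration P A xp x w y"
  obtains s where "s \<in> subdifferential (Hfun P (rho A)) w" "y \<in> feasible"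
    "\<And>v. v \<in> feasible \<Longrightarrow> Gfun P (rho A) y - s \<bullet> y + nu A / 2 * (norm (y - w))\<^sup>2
      \<le> Gfun P (rho A) v - s \<bullet> v + nu A / 2 * (norm (v - w))\<^sup>2"
proof -
  interpret portfolio_model P by (rule P)
  obtain g where g: "\<And>t. g $ t \<in> cvar_subgrads P t (w $ t)"
    and y: "is_arg_min (\<lambda>v. Ghat P (rho A) (nu A) v - ((rho A * Bgam P) *\<^sub>R g + nu A *\<^sub>R w) \<bullet> v)
      (\<lambda>v. v \<in> feasible) y"
    using it unfolding ibdca_iteration_def by blast
  let ?s = "(rho A * Bgam P) *\<^sub>R g"
  have "?s \<in> subdifferential (Hfun P (rho A)) w"
    using A g by (intro Hfun_subgradient) (auto simp: valid_params_def)
  moreover have "y \<in> feasible" using y by (simp add: is_arg_min_def)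
  moreover have "Gfun P (rho A) y - ?s \<bullet> y + nu A / 2 * (norm (y - w))\<^sup>2
      \<le> Gfun P (rho A) v - ?s \<bullet> v + nu A / 2 * (norm (v - w))\<^sup>2" if "v \<in> feasible" for v
  proof -
    have "Ghat P (rho A) (nu A) y - (?s + nu A *\<^sub>R w) \<bullet> y \<le> Ghat P (rho A) (nu A) v - (?s + nu A *\<^sub>R w) \<bullet> v"
      using y that unfolding is_arg_min_def not_less by (meson linorder_not_less)
    then show ?thesis
      using proximal_form[of "nu A" y ?s w] proximal_form[of "nu A" v ?s w]
      unfolding Ghat_def by linarith
  qed
  ultimately show ?thesis by (rule that)
qed

text \<open>The subproblem has growth modulus \<open>lam2 P + nu A / 2\<close>, and its proximal
  term adds \<open>nu A / 2\<close>. The total exceeds \<open>sigma A\<close>, and the subgradient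
  inequality for \<open>H\<close> turns the estimate into one for \<open>Phi\<close>.\<close>

lemma subproblem_descent:
  fixes w y :: "('n::finite, 't::{finite,linorder}) plan"
  assumes P: "portfolio_model P" and A: "valid_params P A"
    and w: "w \<in> feasible" and y: "y \<in> feasible"
    and s: "s \<in> subdifferential (Hfun P (rho A)) w"
    and min: "\<And>v. v \<in> feasible \<Longrightarrow> Gfun P (rho A) y - s \<bullet> y + nu A / 2 * (norm (y - w))\<^sup>2
      \<le> Gfun P (rho A) v - s \<bullet> v + nu A / 2 * (norm (v - w))\<^sup>2"
  shows "Phi P (rho A) y \<le> Phi P (rho A) w - sigma A * (norm (y - w))\<^sup>2"
proof -
  interpret portfolio_model P by (rule P)
  have pars: "rho A > 0" "sigma A \<le> lam2 P + nu A" using A by (auto simp: valid_params_def)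
  let ?u = "s + nu A *\<^sub>R w" and ?c = "lam2 P + nu A / 2"
  have split: "(Gbase P (rho A) v - ?u \<bullet> v) + ?c * (norm v)\<^sup>2
      = Gfun P (rho A) v - s \<bullet> v + nu A / 2 * (norm (v - w))\<^sup>2 - nu A / 2 * (norm w)\<^sup>2" for v
    using proximal_form[of "nu A" v s w] unfolding Gfun_eq by (simp add: distrib_right)
  have "convex_on feasible (\<lambda>v. Gbase P (rho A) v - ?u \<bullet> v)"
    by (rule convex_on_diff_linear[OF convex_on_subset[OF convex_Gbase[OF pars(1)] subset_UNIV convex_feasible]])
  moreover have "(Gbase P (rho A) y - ?u \<bullet> y) + ?c * (norm y)\<^sup>2
      \<le> (Gbase P (rho A) v - ?u \<bullet> v) + ?c * (norm v)\<^sup>2" if "v \<in> feasible" for v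
    unfolding split using min[OF that] by linarith
  ultimately have "(Gbase P (rho A) y - ?u \<bullet> y) + ?c * (norm y)\<^sup>2 + ?c * (norm (w - y))\<^sup>2
      \<le> (Gbase P (rho A) w - ?u \<bullet> w) + ?c * (norm w)\<^sup>2"
    using strongly_convex_minimizer_growth[OF _ y w] by blast
  then have "Gfun P (rho A) y - s \<bullet> y + nu A / 2 * (norm (y - w))\<^sup>2 + ?c * (norm (w - y))\<^sup>2
      \<le> Gfun P (rho A) w - s \<bullet> w"
    unfolding split by simp
  moreover have "Hfun P (rho A) w + s \<bullet> (y - w) \<le> Hfun P (rho A) y"
    using s by (simp add: subdifferential_def)
  moreover have "sigma A * (norm (y - w))\<^sup>2 \<le> (lam2 P + nu A) * (norm (y - w))\<^sup>2"
    using pars by (intro mult_right_mono) auto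
  ultimately show ?thesis
    unfolding Phi_eq_DC by (simp add: norm_minus_commute inner_diff_right distrib_right)
qed

lemma ibdca_infinite_inertial:
  fixes x w y :: "nat \<Rightarrow> ('n::finite, 't::{finite,linorder}) plan"
  assumes P: "portfolio_model P" and A: "valid_params P A" and run: "ibdca_infinite P A x w y"
  shows "\<exists>s. inertial_dc_iteration feasible (Gbase P (rho A)) (Gfun P (rho A)) (Hfun P (rho A))
    (Phi P (rho A)) (lam2 P) (theta A) (nu A) (sigma A) x w y s"
proof -
  interpret portfolio_model P by (rule P)
  have pars: "0 < rho A" "0 \<le> theta A" "theta A < 1" "0 < nu A" "0 < sigma A"
    using A by (auto simp: valid_params_def)
  have x0: "x 0 \<in> feasible" using run by (auto simp: ibdca_infinite_def ibdca_run_def)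
  have it: "ibdca_iteration P A (x (k - 1)) (x k) (w k) (y k)" "\<not> ibdca_stop A (w k) (y k)"
    "x (Suc k) = w k + line_search P A (w k) (y k) *\<^sub>R (y k - w k)" for k
    using run unfolding ibdca_infinite_def ibdca_run_def by (metis lessI)+
  have w: "w k = extrapolate P A (x (k - 1)) (x k)" for k
    using it(1) by (simp add: ibdca_iteration_def)
  have d: "y k \<noteq> w k" for k using it(2)[of k] by (auto simp: ibdca_stop_def)
  have "\<exists>s. s \<in> subdifferential (Hfun P (rho A)) (w k) \<and> y k \<in> feasible \<and>
    (\<forall>v\<in>feasible. Gfun P (rho A) (y k) - s \<bullet> y k + nu A / 2 * (norm (y k - w k))\<^sup>2
      \<le> Gfun P (rho A) v - s \<bullet> v + nu A / 2 * (norm (v - w k))\<^sup>2)" for k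
    by (rule ibdca_iteration_subproblem[OF P A it(1)[of k]]) blast
  then obtain s where s: "\<And>k. s k \<in> subdifferential (Hfun P (rho A)) (w k)" "\<And>k. y k \<in> feasible"
    "\<And>k v. v \<in> feasible \<Longrightarrow> Gfun P (rho A) (y k) - s k \<bullet> y k + nu A / 2 * (norm (y k - w k))\<^sup>2
      \<le> Gfun P (rho A) v - s k \<bullet> v + nu A / 2 * (norm (v - w k))\<^sup>2"
    by metis
  \<comment> \<open>Conditional on feasibility of \<open>x k\<close>, since the induction proving
    feasibility of all iterates uses the second claim.\<close>
  have ls: "1 \<le> line_search P A (w k) (y k)" "x (Suc k) \<in> feasible"
    "Phi P (rho A) (x (Suc k)) \<le> Phi P (rho A) (y k)"
    "Phi P (rho A) (x (Suc k)) \<le> Phi P (rho A) (w k) - sigma A * (norm (x (Suc k) - w k))\<^sup>2"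
    if "x k \<in> feasible" for k
  proof -
    have wk: "w k \<in> feasible" using extrapolate_spec(1)[OF that pars(2)] w by simp
    note line_search_spec[OF A wk s(2) d subproblem_descent[OF P A wk s(2) s(1) s(3)]]
    then show "1 \<le> line_search P A (w k) (y k)" "x (Suc k) \<in> feasible"
      "Phi P (rho A) (x (Suc k)) \<le> Phi P (rho A) (y k)"
      "Phi P (rho A) (x (Suc k)) \<le> Phi P (rho A) (w k) - sigma A * (norm (x (Suc k) - w k))\<^sup>2"
      by (simp_all add: it(3))
  qed
  have x: "x k \<in> feasible" for k by (induction k) (use x0 ls(2) in auto)
  have "inertial_dc_iteration feasible (Gbase P (rho A)) (Gfun P (rho A)) (Hfun P (rho A))
    (Phi P (rho A)) (lam2 P) (theta A) (nu A) (sigma A) x w y s"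
  proof
    show "norm (y k - w k) \<le> norm (x (Suc k) - w k)" for k
      using ls(1)[OF x, of k] mult_right_mono[of 1 "line_search P A (w k) (y k)" "norm (y k - w k)"]
      by (simp add: it(3))
    show "norm (w k - x k) \<le> theta A * norm (x k - x (k - 1))" for k
      unfolding w by (rule extrapolate_spec(2)[OF x pars(2)])
    show "w k \<in> feasible" "Phi P (rho A) (w k) \<le> Phi P (rho A) (x k)" for k
      unfolding w by (rule extrapolate_spec[OF x pars(2)])+
  qed (use convex_feasible closed_feasible convex_Gbase convex_Hfun Gfun_eq Phi_eq_DC pars lam2_pos x s ls in auto)
  then show ?thesis by blast
qed

theorem theorem4p2:
  fixes P :: "('w, 'n::finite, 't::{finite,linorder}) portfolio"
    and A :: ibdca_params
  assumes "portfolio_model P" and "valid_params P A"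
  shows
    "(\<forall>x w y k r. ibdca_returns P A x w y k r \<and> y k - w k = 0 \<longrightarrow>
        dc_critical feasible (Gfun P (rho A)) (Hfun P (rho A)) r) \<and>
     (\<forall>x w y xbar. ibdca_infinite P A x w y \<and>
        (\<exists>\<phi>::nat \<Rightarrow> nat. strict_mono \<phi> \<and> (x \<circ> \<phi>) \<longlonglongrightarrow> xbar) \<and>
        (\<forall>t. is_singleton (Mset P (level P) t (xbar $ t))) \<longrightarrow>
        summable (\<lambda>k. norm (x (Suc k) - x k)) \<and>
        x \<longlonglongrightarrow> xbar \<and>
        dc_critical feasible (Gfun P (rho A)) (Hfun P (rho A)) xbar \<and>
        (\<exists>C>0. \<exists>\<omega>. 0 < \<omega> \<and> \<omega> < 1 \<and>
          (\<exists>K::nat. \<forall>k\<ge>K. norm (x k - xbar) \<le> C * \<omega> ^ (k - K))))"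
proof (intro conjI[of "All _"] allI impI)
  interpret portfolio_model P by (rule assms(1))
  fix x w y :: "nat \<Rightarrow> ('n, 't) plan" and k r
  assume "ibdca_returns P A x w y k r \<and> y k - w k = 0"
  \<comment> \<open>With zero direction \<open>w k\<close> solves its own subproblem, so it is a
    proximal fixed point and minimizes the linearized function.\<close>
  then have it: "ibdca_iteration P A (x (k - 1)) (x k) (w k) (w k)" and r: "r = w k"
    by (auto simp: ibdca_returns_def)
  obtain s where s: "s \<in> subdifferential (Hfun P (rho A)) (w k)" "w k \<in> feasible"
    "\<And>v. v \<in> feasible \<Longrightarrow> Gfun P (rho A) (w k) - s \<bullet> w k + nu A / 2 * (norm (w k - w k))\<^sup>2
      \<le> Gfun P (rho A) v - s \<bullet> v + nu A / 2 * (norm (v - w k))\<^sup>2"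
    using ibdca_iteration_subproblem[OF assms it] by blast
  have G: "convex_on UNIV (Gfun P (rho A))"
    using assms(2) by (intro convex_Gfun) (simp add: valid_params_def)
  have G': "convex_on feasible (\<lambda>v. Gfun P (rho A) v - s \<bullet> v)"
    by (rule convex_on_diff_linear[OF convex_on_subset[OF G subset_UNIV convex_feasible]])
  show "dc_critical feasible (Gfun P (rho A)) (Hfun P (rho A)) r"
    unfolding r
  proof (rule dc_critical_of_linearized_minimizer[OF G convex_feasible s(2,1)])
    fix v :: "('n, 't) plan"
    assume "v \<in> feasible"
    from proximal_fixed_point_minimizes[OF G' s(2) this, of "nu A / 2"] s(3)
    show "Gfun P (rho A) (w k) - s \<bullet> w k \<le> Gfun P (rho A) v - s \<bullet> v" by simp
  qed
next
  interpret portfolio_model P by (rule assms(1))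
  fix x w y :: "nat \<Rightarrow> ('n, 't) plan" and xbar
  assume *: "ibdca_infinite P A x w y \<and>
    (\<exists>\<phi>::nat \<Rightarrow> nat. strict_mono \<phi> \<and> (x \<circ> \<phi>) \<longlonglongrightarrow> xbar) \<and>
    (\<forall>t. is_singleton (Mset P (level P) t (xbar $ t)))"
  then obtain \<phi> :: "nat \<Rightarrow> nat" where \<phi>: "strict_mono \<phi>" "(x \<circ> \<phi>) \<longlonglongrightarrow> xbar" by blast
  obtain s where "inertial_dc_iteration feasible (Gbase P (rho A)) (Gfun P (rho A)) (Hfun P (rho A))
    (Phi P (rho A)) (lam2 P) (theta A) (nu A) (sigma A) x w y s"
    using ibdca_infinite_inertial[OF assms] * by blast
  then interpret inertial_dc_iteration feasible "Gbase P (rho A)" "Gfun P (rho A)" "Hfun P (rho A)"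
    "Phi P (rho A)" "lam2 P" "theta A" "nu A" "sigma A" x w y s .
  obtain h r where hr: "r > 0"
    "\<And>z. z \<in> ball xbar r \<Longrightarrow> Hfun P (rho A) z = Hfun P (rho A) xbar + h \<bullet> (z - xbar)"
    using Hfun_locally_affine * by metis
  show "summable (\<lambda>k. norm (x (Suc k) - x k)) \<and> x \<longlonglongrightarrow> xbar \<and>
      dc_critical feasible (Gfun P (rho A)) (Hfun P (rho A)) xbar \<and>
      (\<exists>C>0. \<exists>\<omega>. 0 < \<omega> \<and> \<omega> < 1 \<and>
        (\<exists>K::nat. \<forall>k\<ge>K. norm (x k - xbar) \<le> C * \<omega> ^ (k - K)))"
    using finite_length[OF \<phi> hr] x_tendsto[OF \<phi> hr] a_critical[OF \<phi> hr] linear_rate[OF \<phi> hr]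
    by (intro conjI)
qed

end
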